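(* Let $k$ be a field. Let $G$ be a group, and let $m\ge1$ be an integer. For $1\le i\le m$, let $\rho_i\colon G\to\mathrm{GL}(V_i)$ be a linear representation of $G$ on a finite-dimensional $k$-vector space $V_i$. Denote by $G_i$ the Zariski closure of the image of $\rho_i$, and let $N_i$ be a normal subgroup of $G_i$. Assume that $N_i$ is perfect and that the space of $N_i$-coinvariants of $V_i$ is zero. For $i\ne j$, let $(H_{i,j},H_{j,i},\varphi_{ij})$ denote the Goursat datum for the image in $G_i\times G_j$ of the Zariski closure $\overline G$ of the image of $G$ in $G_1\times\cdots\times G_m$. Then one of the following properties holds: (1) The space of $G$-coinvariants of the representation $\rho=\rho_1\otimes\cdots\otimes\rho_m$ is zero. (2) For each $i$ with $1\le i\le m$, there exists an integer $j\ne i$ with $1\le j\le m$ such that $N_i$ is not contained in $H_{i,j}$.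
   Context: Linear algebraic groups over $k$ are identified with their groups of points over an algebraic closure of $k$ (and the $V_i$ are extended to this closure when needed). A group is perfect if it is equal to its commutator subgroup. Goursat datum: let $G_1,G_2$ be groups and $\Gamma\subset G_1\times G_2$ a subgroup both of whose projections to $G_1$ and $G_2$ are surjective. Let $H_1=\{x\in G_1: (x,1)\in\Gamma\}$ and $H_2=\{y\in G_2:(1,y)\in\Gamma\}$, which are normal subgroups of $G_1$ and $G_2$. There is an isomorphism $\varphi\colon G_1/H_1\to G_2/H_2$ such that $H_1\times H_2\subset\Gamma=\{(x,y)\in G_1\times G_2:\varphi(xH_1)=yH_2\}$. The triple $(H_1,H_2,\varphi)$ is the Goursat datum of $\Gamma$. *)

theory Defs
  imports
    "HOL-Algebra.Algebraic_Closure_Type"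
    "HOL-Algebra.Product_Groups"
    "HOL-Algebra.Generated_Groups"
    "HOL-Algebra.Bij"
    "HOL-Library.Function_Algebras"
begin

text \<open>
  Vector spaces are linear subspaces \<open>V\<close> of an ambient vector space whose scalar
  multiplication is \<open>s\<close>; a family of subspaces of one ambient space may have members of
  different dimensions, and every finite family of vector spaces arises in this way, inside its
  direct sum.
\<close>

definition fin_dim_subspace :: "('k::field \<Rightarrow> 'v::ab_group_add \<Rightarrow> 'v) \<Rightarrow> 'v set \<Rightarrow> bool" where
  "fin_dim_subspace s V \<longleftrightarrow>
     Modules.module.subspace s V \<and> (\<exists>B. finite B \<and> Modules.module.span s B = V)"

definition linear_on ::
  "('k::field \<Rightarrow> 'v::ab_group_add \<Rightarrow> 'v) \<Rightarrow> 'v set \<Rightarrow> ('k \<Rightarrow> 'w::ab_group_add \<Rightarrow> 'w) \<Rightarrow> ('v \<Rightarrow> 'w) \<Rightarrow> bool"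
  where "linear_on s V t f \<longleftrightarrow>
     (\<forall>x\<in>V. \<forall>y\<in>V. f (x + y) = f x + f y) \<and> (\<forall>c. \<forall>x\<in>V. f (s c x) = t c (f x))"

definition GL :: "('k::field \<Rightarrow> 'v::ab_group_add \<Rightarrow> 'v) \<Rightarrow> 'v set \<Rightarrow> ('v \<Rightarrow> 'v) monoid" where
  "GL s V = (BijGroup V)\<lparr>carrier := {f \<in> Bij V. linear_on s V s f}\<rparr>"

text \<open>Linear forms on \<open>V\<close> are extended by 0 outside \<open>V\<close>.\<close>

definition dual_space :: "('k::field \<Rightarrow> 'v::ab_group_add \<Rightarrow> 'v) \<Rightarrow> 'v set \<Rightarrow> ('v \<Rightarrow> 'k) set" where
  "dual_space s V = {f. linear_on s V (*) f \<and> (\<forall>x. x \<notin> V \<longrightarrow> f x = 0)}"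

definition fun_scale :: "'k::field \<Rightarrow> ('x \<Rightarrow> 'k) \<Rightarrow> 'x \<Rightarrow> 'k" where
  "fun_scale c f = (\<lambda>x. c * f x)"

text \<open>
  The coinvariants of a set \<open>A\<close> of endomorphisms of \<open>V\<close>: the quotient, as a set of
  cosets, of \<open>V\<close> by the span of all \<open>a v - v\<close>. Its zero element is the coset of 0, which
  is \<open>coinv_kernel s A V\<close>.
\<close>

definition coinv_kernel ::
  "('k::field \<Rightarrow> 'v::ab_group_add \<Rightarrow> 'v) \<Rightarrow> ('v \<Rightarrow> 'v) set \<Rightarrow> 'v set \<Rightarrow> 'v set" where
  "coinv_kernel s A V = Modules.module.span s {a v - v | a v. a \<in> A \<and> v \<in> V}"

definition coinvariants ::
  "('k::field \<Rightarrow> 'v::ab_group_add \<Rightarrow> 'v) \<Rightarrow> ('v \<Rightarrow> 'v) set \<Rightarrow> 'v set \<Rightarrow> 'v set set" where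
  "coinvariants s A V = (\<lambda>v. (\<lambda>r. v + r) ` coinv_kernel s A V) ` V"

definition coinvariants_zero ::
  "('k::field \<Rightarrow> 'v::ab_group_add \<Rightarrow> 'v) \<Rightarrow> ('v \<Rightarrow> 'v) set \<Rightarrow> 'v set \<Rightarrow> bool" where
  "coinvariants_zero s A V \<longleftrightarrow> coinvariants s A V = {coinv_kernel s A V}"

lemma vector_space_fun_scale: "vector_space (fun_scale :: 'k::field \<Rightarrow> ('x \<Rightarrow> 'k) \<Rightarrow> _)"
  by unfold_locales (auto simp: fun_scale_def fun_eq_iff algebra_simps)

lemma sum_fun_scale_apply: "(\<Sum>x\<in>T. fun_scale (c x) (e x)) f = (\<Sum>x\<in>T. c x * e x f)"
  by (induction T rule: infinite_finite_induct) (auto simp: fun_scale_def)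

lemma linear_extension_on_span:
  assumes "vector_space s1" and "vector_space s2"
    and rel: "\<And>T c. finite T \<Longrightarrow> T \<subseteq> E \<Longrightarrow> (\<Sum>x\<in>T. s1 (c x) (e x)) = 0 \<Longrightarrow> (\<Sum>x\<in>T. s2 (c x) (F x)) = 0"
  defines "W \<equiv> Modules.module.span s1 (e ` E)"
  shows "\<exists>!h. h \<in> extensional W \<and> linear_on s1 W s2 h \<and> (\<forall>x\<in>E. h (e x) = F x)"
proof -
  interpret p: vector_space_pair s1 s2
    using assms(1,2) by (simp add: vector_space_pair_def)
  obtain B where B: "B \<subseteq> e ` E" "p.vs1.independent B" "e ` E \<subseteq> p.vs1.span B"
    using p.vs1.maximal_independent_subset by metis
  define i where "i = inv_into E e"
  have i: "i b \<in> E" "e (i b) = b" if "b \<in> B" for b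
    using that B(1) by (auto simp: i_def inv_into_into f_inv_into_f)
  have inj_i: "inj_on i B" by (rule inj_on_inverseI[of _ e]) (use i in auto)
  define h where "h = p.construct B (\<lambda>b. F (i b))"
  have lin: "Vector_Spaces.linear s1 s2 h" unfolding h_def by (rule p.linear_construct[OF B(2)])
  interpret h: Vector_Spaces.linear s1 s2 h by (rule lin)
  have h: "h (e x) = F x" if x: "x \<in> E" for x
  proof -
    have hb: "h b = F (i b)" if "b \<in> B" for b
      unfolding h_def by (rule p.construct_basis[OF B(2) that])
    from x B(3) have "e x \<in> p.vs1.span B" by auto
    then obtain T r where T: "finite T" "T \<subseteq> B" "e x = (\<Sum>b\<in>T. s1 (r b) b)"
      unfolding p.vs1.span_explicit by auto
    show ?thesis
    proof (cases "x \<in> i ` T")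
      case True
      with T hb i show ?thesis by auto
    next
      case False
      define c where "c y = (if y = x then 1 else - r (e y))" for y
      have inj: "inj_on i T" using inj_i T(2) by (rule inj_on_subset)
      have *: "c (i b) = - r b" "e (i b) = b" if "b \<in> T" for b
        using that False i T(2) by (auto simp: c_def)
      have 1: "(\<Sum>y\<in>insert x (i ` T). s1 (c y) (e y)) = e x - (\<Sum>b\<in>T. s1 (r b) b)"
        using T(1) False inj by (simp add: sum.reindex * c_def[of x] sum_negf)
      have 2: "(\<Sum>y\<in>insert x (i ` T). s2 (c y) (F y)) = F x - (\<Sum>b\<in>T. s2 (r b) (F (i b)))"
        using T(1) False inj by (simp add: sum.reindex * c_def[of x] sum_negf)
      have "(\<Sum>y\<in>insert x (i ` T). s2 (c y) (F y)) = 0"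
        by (rule rel) (use 1 T i x in auto)
      with 2 have "F x = (\<Sum>b\<in>T. s2 (r b) (F (i b)))" by simp
      also have "\<dots> = h (e x)"
        unfolding T(3) h.sum h.scale using T(2) hb by (intro sum.cong) auto
      finally show ?thesis by simp
    qed
  qed
  show ?thesis
  proof (rule ex_ex1I)
    have "e x \<in> W" if "x \<in> E" for x
      using that unfolding W_def by (auto intro: p.vs1.span_base)
    moreover have "x + y \<in> W" "s1 c x \<in> W" if "x \<in> W" "y \<in> W" for x y c
      using that unfolding W_def by (auto intro: p.vs1.span_add p.vs1.span_scale)
    ultimately show "\<exists>h. h \<in> extensional W \<and> linear_on s1 W s2 h \<and> (\<forall>x\<in>E. h (e x) = F x)"
      by (intro exI[of _ "restrict h W"]) (auto simp: linear_on_def h.add h.scale h)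
  next
    fix f g
    assume f: "f \<in> extensional W \<and> linear_on s1 W s2 f \<and> (\<forall>x\<in>E. f (e x) = F x)"
      and g: "g \<in> extensional W \<and> linear_on s1 W s2 g \<and> (\<forall>x\<in>E. g (e x) = F x)"
    have z: "0 \<in> W" unfolding W_def by (rule p.vs1.span_zero)
    have f0: "f 0 = 0" and g0: "g 0 = 0" 
      using f g z unfolding linear_on_def by (metis add_0 add_left_cancel add.right_neutral)+
    have "w \<in> W \<and> f w = g w" if "w \<in> W" for w
      using that unfolding W_def
    proof (induction rule: p.vs1.span_induct_alt)
      case base show ?case using f0 g0 z W_def by auto
    next
      case (step c x y)
      then obtain u where u: "u \<in> E" "x = e u" by auto
      have "x \<in> W" using step W_def by (auto intro: p.vs1.span_base)
      then have "s1 c x \<in> W" unfolding W_def by (rule p.vs1.span_scale)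
      moreover have "y \<in> W" using step W_def by auto
      ultimately have "s1 c x + y \<in> W" unfolding W_def by (rule p.vs1.span_add)
      with \<open>x \<in> W\<close> \<open>s1 c x \<in> W\<close> \<open>y \<in> W\<close> f g u step show ?case
        unfolding linear_on_def W_def by simp
    qed
    then show "f = g" using f g by (auto intro: extensionalityI)
  qed
qed

lemma linear_on_sum:
  assumes "vector_space s" "Modules.module.subspace s V" "vector_space t" "linear_on s V (\<lambda>c. t (\<iota> c)) F"
    "finite T" "\<And>x. x \<in> T \<Longrightarrow> g x \<in> V"
  shows "F (\<Sum>x\<in>T. s (c x) (g x)) = (\<Sum>x\<in>T. t (\<iota> (c x)) (F (g x)))"
proof -
  interpret vector_space s by fact
  have F0: "F 0 = 0" using assms(2,4) unfolding linear_on_def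
    by (metis add_0 add_left_cancel add.right_neutral subspace_0)
  have "(\<Sum>x\<in>T. s (c x) (g x)) \<in> V \<and> F (\<Sum>x\<in>T. s (c x) (g x)) = (\<Sum>x\<in>T. t (\<iota> (c x)) (F (g x)))"
    using assms(5,6)
  proof (induction T rule: finite_induct)
    case empty then show ?case using F0 assms(2) by (auto simp: subspace_0)
  next
    case (insert x T)
    then have "s (c x) (g x) \<in> V" using assms(2) by (auto intro: subspace_scale)
    with insert show ?case using assms(2,4) by (auto simp: linear_on_def intro: subspace_add)
  qed
  then show ?thesis ..
qed


text \<open>
  Extension of scalars of a finite-dimensional \<open>V\<close> to the algebraic closure \<open>K\<close> of \<open>k\<close>.
  The tensor product of \<open>K\<close> and \<open>V\<close> is realised as the space of \<open>k\<close>-linear maps from the dual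
  of \<open>V\<close> to \<open>K\<close>, that is, as the \<open>K\<close>-span of the evaluations \<open>ext_vec s V v\<close>, which stand for
  the tensors of 1 with \<open>v\<close>. The universal property is \<open>scalar_ext_universal\<close> below, and
  \<open>ext_map s V g\<close> is the \<open>K\<close>-linear extension of \<open>g\<close> (\<open>ext_map_ext_vec\<close>, \<open>linear_on_ext_map\<close>).
\<close>

type_synonym ('k, 'v) ext_vector = "('v \<Rightarrow> 'k) \<Rightarrow> 'k alg_closure"

definition ext_vec ::
  "('k::field \<Rightarrow> 'v::ab_group_add \<Rightarrow> 'v) \<Rightarrow> 'v set \<Rightarrow> 'v \<Rightarrow> ('k, 'v) ext_vector" where
  "ext_vec s V v = (\<lambda>f. if f \<in> dual_space s V then to_ac (f v) else 0)"

definition scalar_ext ::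
  "('k::field \<Rightarrow> 'v::ab_group_add \<Rightarrow> 'v) \<Rightarrow> 'v set \<Rightarrow> ('k, 'v) ext_vector set" where
  "scalar_ext s V = Modules.module.span fun_scale (ext_vec s V ` V)"

definition ext_map ::
  "('k::field \<Rightarrow> 'v::ab_group_add \<Rightarrow> 'v) \<Rightarrow> 'v set \<Rightarrow> ('v \<Rightarrow> 'v)
    \<Rightarrow> ('k, 'v) ext_vector \<Rightarrow> ('k, 'v) ext_vector" where
  "ext_map s V g = (\<lambda>w\<in>scalar_ext s V.
     \<lambda>f. if f \<in> dual_space s V then w (\<lambda>x. if x \<in> V then f (g x) else 0) else 0)"

lemma linear_on_ext_vec:
  assumes "vector_space s" "Modules.module.subspace s V"
  shows "linear_on s V (\<lambda>c. fun_scale (to_ac c)) (ext_vec s V)"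
  using assms
  by (auto simp: linear_on_def ext_vec_def dual_space_def fun_scale_def fun_eq_iff)

lemma scalar_ext_universal:
  fixes s :: "'k::field \<Rightarrow> 'v::ab_group_add \<Rightarrow> 'v" and t :: "'k alg_closure \<Rightarrow> 'u::ab_group_add \<Rightarrow> 'u"
  assumes s: "vector_space s" and V: "fin_dim_subspace s V" and t: "vector_space t"
    and F: "linear_on s V (\<lambda>c. t (to_ac c)) F"
  shows "\<exists>!h. h \<in> extensional (scalar_ext s V) \<and> linear_on fun_scale (scalar_ext s V) t h \<and>
              (\<forall>v\<in>V. h (ext_vec s V v) = F v)"
  unfolding scalar_ext_def
proof (rule linear_extension_on_span[OF vector_space_fun_scale t])
  interpret s: vector_space s by fact
  interpret t: vector_space t by fact
  fix T c
  assume T: "finite T" "T \<subseteq> V" and z: "(\<Sum>v\<in>T. fun_scale (c v) (ext_vec s V v)) = 0"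
  have sub: "s.subspace V" using V by (simp add: fin_dim_subspace_def)
  from V obtain A where A: "finite A" "s.span A = V" unfolding fin_dim_subspace_def by auto
  obtain B where B: "B \<subseteq> A" "s.independent B" "A \<subseteq> s.span B"
    using s.maximal_independent_subset by metis
  have spB: "s.span B = V" using B A by (metis s.span_eq s.span_mono s.span_span)
  have finB: "finite B" using A B finite_subset by auto
  have BV: "B \<subseteq> V" using spB s.span_superset by auto
  define d where "d b x = s.representation B x b" for b x
  have "d b x = 0" if "x \<notin> V" for b x
    using that spB by (simp add: d_def s.representation_def)
  then have d: "d b \<in> dual_space s V" for b
    using spB by (auto simp: dual_space_def linear_on_def d_def s.representation_add[OF B(2)] s.representation_scale[OF B(2)])
  have rep: "x = (\<Sum>b\<in>B. s (d b x) b)" if "x \<in> V" for x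
    unfolding d_def using s.sum_representation_eq[OF B(2), of x B] that spB finB by auto
  have Fx: "F x = (\<Sum>b\<in>B. t (to_ac (d b x)) (F b))" if "x \<in> V" for x
    using linear_on_sum[OF s sub t F finB, of "\<lambda>b. b" "\<lambda>b. d b x"] rep[OF that] BV by auto
  have "(\<Sum>x\<in>T. t (c x) (F x)) = (\<Sum>x\<in>T. \<Sum>b\<in>B. t (c x * to_ac (d b x)) (F b))"
    using T(2) by (intro sum.cong refl) (subst Fx, auto simp: t.scale_sum_right)
  also have "\<dots> = (\<Sum>b\<in>B. t (\<Sum>x\<in>T. c x * to_ac (d b x)) (F b))"
    by (subst sum.swap) (simp add: t.scale_sum_left)
  also have "\<dots> = 0"
  proof (rule sum.neutral, rule ballI)
    fix b assume "b \<in> B"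
    have "(\<Sum>x\<in>T. c x * to_ac (d b x)) = (\<Sum>v\<in>T. fun_scale (c v) (ext_vec s V v)) (d b)"
      unfolding sum_fun_scale_apply using d by (simp add: ext_vec_def)
    then show "t (\<Sum>x\<in>T. c x * to_ac (d b x)) (F b) = 0" using z by simp
  qed
  finally show "(\<Sum>x\<in>T. t (c x) (F x)) = 0" .
qed

lemma dual_space_compose:
  assumes "f \<in> dual_space s V" "g ` V \<subseteq> V" "linear_on s V s g" "vector_space s" "Modules.module.subspace s V"
  shows "(\<lambda>x. if x \<in> V then f (g x) else 0) \<in> dual_space s V"
proof -
  interpret vector_space s by fact
  show ?thesis using assms by (auto simp: dual_space_def linear_on_def subspace_def image_subset_iff)
qed

lemma ext_map_ext_vec:
  assumes "vector_space s" "Modules.module.subspace s V" "g \<in> carrier (GL s V)" "v \<in> V"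
  shows "ext_map s V g (ext_vec s V v) = ext_vec s V (g v)"
proof -
  interpret K: vector_space "fun_scale :: 'a alg_closure \<Rightarrow> ('a, 'b) ext_vector \<Rightarrow> _" by (rule vector_space_fun_scale)
  have "g ` V \<subseteq> V" "linear_on s V s g" using assms(3) by (auto simp: GL_def Bij_def bij_betw_def)
  then have "(\<lambda>x. if x \<in> V then f (g x) else 0) \<in> dual_space s V" if "f \<in> dual_space s V" for f
    using that dual_space_compose assms by blast
  moreover have "ext_vec s V v \<in> scalar_ext s V" unfolding scalar_ext_def using assms by (auto intro: K.span_base)
  ultimately show ?thesis using assms(4) by (auto simp: ext_map_def ext_vec_def fun_eq_iff)
qed

lemma linear_on_ext_map: "linear_on fun_scale (scalar_ext s V) fun_scale (ext_map s V g)"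
proof -
  interpret K: vector_space "fun_scale :: 'a alg_closure \<Rightarrow> ('a, 'b) ext_vector \<Rightarrow> _" by (rule vector_space_fun_scale)
  have "K.subspace (scalar_ext s V)" unfolding scalar_ext_def by (rule K.subspace_span)
  then show ?thesis unfolding K.subspace_def
    by (auto simp: linear_on_def ext_map_def fun_scale_def fun_eq_iff)
qed


text \<open>
  The tensor product of a finite family \<open>V i\<close> of vector spaces (\<open>i \<in> I\<close>), realised inside
  the dual of the space of multilinear forms on the \<open>V i\<close>: the pure tensor of \<open>x\<close> is
  evaluation at \<open>x\<close>. The universal property is \<open>tensor_space_universal\<close> below.
  \<open>tensor_map s I V g\<close> is the tensor product of the endomorphisms \<open>g i\<close>
  (\<open>tensor_map_pure_tensor\<close>, \<open>linear_on_tensor_map\<close>).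
\<close>

definition multilinear_on ::
  "('k::field \<Rightarrow> 'v::ab_group_add \<Rightarrow> 'v) \<Rightarrow> 'i set \<Rightarrow> ('i \<Rightarrow> 'v set)
    \<Rightarrow> ('k \<Rightarrow> 'w::ab_group_add \<Rightarrow> 'w) \<Rightarrow> (('i \<Rightarrow> 'v) \<Rightarrow> 'w) \<Rightarrow> bool" where
  "multilinear_on s I V t F \<longleftrightarrow>
     (\<forall>x \<in> Pi\<^sub>E I V. \<forall>i\<in>I. linear_on s (V i) t (\<lambda>v. F (x(i := v))))"

definition multilinear_forms ::
  "('k::field \<Rightarrow> 'v::ab_group_add \<Rightarrow> 'v) \<Rightarrow> 'i set \<Rightarrow> ('i \<Rightarrow> 'v set) \<Rightarrow> (('i \<Rightarrow> 'v) \<Rightarrow> 'k) set" where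
  "multilinear_forms s I V =
     {b. multilinear_on s I V (*) b \<and> (\<forall>x. x \<notin> Pi\<^sub>E I V \<longrightarrow> b x = 0)}"

type_synonym ('k, 'i, 'v) tensor = "(('i \<Rightarrow> 'v) \<Rightarrow> 'k) \<Rightarrow> 'k"

definition pure_tensor ::
  "('k::field \<Rightarrow> 'v::ab_group_add \<Rightarrow> 'v) \<Rightarrow> 'i set \<Rightarrow> ('i \<Rightarrow> 'v set) \<Rightarrow> ('i \<Rightarrow> 'v)
    \<Rightarrow> ('k, 'i, 'v) tensor" where
  "pure_tensor s I V x = (\<lambda>b. if b \<in> multilinear_forms s I V then b x else 0)"

definition tensor_space ::
  "('k::field \<Rightarrow> 'v::ab_group_add \<Rightarrow> 'v) \<Rightarrow> 'i set \<Rightarrow> ('i \<Rightarrow> 'v set) \<Rightarrow> ('k, 'i, 'v) tensor set" where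
  "tensor_space s I V = Modules.module.span fun_scale (pure_tensor s I V ` Pi\<^sub>E I V)"

definition tensor_map ::
  "('k::field \<Rightarrow> 'v::ab_group_add \<Rightarrow> 'v) \<Rightarrow> 'i set \<Rightarrow> ('i \<Rightarrow> 'v set) \<Rightarrow> ('i \<Rightarrow> 'v \<Rightarrow> 'v)
    \<Rightarrow> ('k, 'i, 'v) tensor \<Rightarrow> ('k, 'i, 'v) tensor" where
  "tensor_map s I V g = (\<lambda>t\<in>tensor_space s I V.
     \<lambda>b. if b \<in> multilinear_forms s I V
         then t (\<lambda>x. if x \<in> Pi\<^sub>E I V then b (\<lambda>i\<in>I. g i (x i)) else 0) else 0)"

lemma multilinear_on_pure_tensor:
  assumes "vector_space s" "\<And>i. i \<in> I \<Longrightarrow> Modules.module.subspace s (V i)"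
  shows "multilinear_on s I V fun_scale (pure_tensor s I V)"
  by (auto simp: multilinear_on_def linear_on_def pure_tensor_def multilinear_forms_def fun_scale_def fun_eq_iff)

lemma tensor_space_universal:
  fixes s :: "'k::field \<Rightarrow> 'v::ab_group_add \<Rightarrow> 'v" and t :: "'k \<Rightarrow> 'u::ab_group_add \<Rightarrow> 'u"
  assumes s: "vector_space s" and V: "\<And>i. i \<in> I \<Longrightarrow> Modules.module.subspace s (V i)"
    and t: "vector_space t" and F: "multilinear_on s I V t F"
  shows "\<exists>!h. h \<in> extensional (tensor_space s I V) \<and> linear_on fun_scale (tensor_space s I V) t h \<and>
              (\<forall>x\<in>Pi\<^sub>E I V. h (pure_tensor s I V x) = F x)"
  unfolding tensor_space_def
proof (rule linear_extension_on_span[OF vector_space_fun_scale t])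
  interpret s: vector_space s by fact
  interpret t: vector_space t by fact
  have "vector_space ((*) :: 'k \<Rightarrow> 'k \<Rightarrow> 'k)" by unfold_locales (auto simp: algebra_simps)
  then interpret p: vector_space_pair t "(*) :: 'k \<Rightarrow> 'k \<Rightarrow> 'k"
    using t by (simp add: vector_space_pair_def)
  fix T c
  assume T: "finite T" "T \<subseteq> Pi\<^sub>E I V" and z: "(\<Sum>x\<in>T. fun_scale (c x) (pure_tensor s I V x)) = 0"
  show "(\<Sum>x\<in>T. t (c x) (F x)) = 0" (is "?u = 0")
  proof (rule ccontr)
    assume "?u \<noteq> 0"
    then have ind: "t.independent {?u}" by (simp add: t.dependent_single)
    define f where "f = p.construct {?u} (\<lambda>_. 1)"
    have fu: "f ?u = 1" unfolding f_def by (rule p.construct_basis[OF ind]) simp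
    have "Vector_Spaces.linear t (*) f" unfolding f_def by (rule p.linear_construct[OF ind])
    then interpret f: Vector_Spaces.linear t "(*)" f .
    define b where "b x = (if x \<in> Pi\<^sub>E I V then f (F x) else 0)" for x
    have upd: "x(i := v) \<in> Pi\<^sub>E I V" if "x \<in> Pi\<^sub>E I V" "i \<in> I" "v \<in> V i" for x i v
      using that by (auto simp: PiE_iff extensional_def)
    have "b \<in> multilinear_forms s I V"
      unfolding multilinear_forms_def multilinear_on_def
    proof (intro CollectI conjI ballI allI impI)
      fix x i assume xi: "x \<in> Pi\<^sub>E I V" "i \<in> I"
      then have "linear_on s (V i) t (\<lambda>v. F (x(i := v)))" using F by (auto simp: multilinear_on_def)
      then show "linear_on s (V i) (*) (\<lambda>v. b (x(i := v)))"
        using upd[OF xi] s.subspace_add[OF V[OF xi(2)]] s.subspace_scale[OF V[OF xi(2)]]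
        by (auto simp: linear_on_def b_def f.add f.scale)
    qed (simp add: b_def)
    then have "(\<Sum>x\<in>T. fun_scale (c x) (pure_tensor s I V x)) b = (\<Sum>x\<in>T. c x * f (F x))"
      unfolding sum_fun_scale_apply using T(2) by (intro sum.cong) (auto simp: pure_tensor_def b_def)
    also have "\<dots> = f ?u" by (simp add: f.sum f.scale)
    finally show False using z fu by simp
  qed
qed

lemma tensor_map_pure_tensor:
  assumes s: "vector_space s" and V: "\<And>i. i \<in> I \<Longrightarrow> Modules.module.subspace s (V i)"
    and g: "\<And>i. i \<in> I \<Longrightarrow> g i \<in> carrier (GL s (V i))" and x: "x \<in> Pi\<^sub>E I V"
  shows "tensor_map s I V g (pure_tensor s I V x) = pure_tensor s I V (\<lambda>i\<in>I. g i (x i))"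
proof -
  interpret s: vector_space s by fact
  interpret T: vector_space "fun_scale :: 'a \<Rightarrow> ('a, 'c, 'b) tensor \<Rightarrow> _" by (rule vector_space_fun_scale)
  have gV: "g i v \<in> V i" if "v \<in> V i" "i \<in> I" for i v
    using g[OF that(2)] that(1) by (auto simp: GL_def Bij_def bij_betw_def)
  have glin: "linear_on s (V i) s (g i)" if "i \<in> I" for i
    using g[OF \<open>i \<in> I\<close>] that by (auto simp: GL_def)
  have "(\<lambda>x. if x \<in> Pi\<^sub>E I V then b (\<lambda>i\<in>I. g i (x i)) else 0) \<in> multilinear_forms s I V" (is "?b \<in> _")
    if b: "b \<in> multilinear_forms s I V" for b
    unfolding multilinear_forms_def multilinear_on_def
  proof (intro CollectI conjI ballI allI impI)
    fix x i assume xi: "x \<in> Pi\<^sub>E I V" "i \<in> I"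
    define y where "y = (\<lambda>i\<in>I. g i (x i))"
    have y: "y \<in> Pi\<^sub>E I V" using xi gV(1) by (auto simp: y_def PiE_iff)
    have upd: "x(i := v) \<in> Pi\<^sub>E I V" if "v \<in> V i" for v
      using that xi by (auto simp: PiE_iff extensional_def)
    have "(\<lambda>j\<in>I. g j ((x(i := v)) j)) = y(i := g i v)" for v
      using xi by (auto simp: y_def fun_eq_iff)
    then have eq: "?b (x(i := v)) = b (y(i := g i v))" if "v \<in> V i" for v using upd[OF that] by simp
    have bl: "linear_on s (V i) (*) (\<lambda>v. b (y(i := v)))"
      using b y xi by (auto simp: multilinear_forms_def multilinear_on_def)
    show "linear_on s (V i) (*) (\<lambda>v. ?b (x(i := v)))"
      using bl glin[OF xi(2)] gV(1)[OF _ xi(2)] s.subspace_add[OF V[OF xi(2)]] s.subspace_scale[OF V[OF xi(2)]]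
      unfolding linear_on_def by (simp add: eq)
  qed simp
  moreover have "pure_tensor s I V x \<in> tensor_space s I V"
    unfolding tensor_space_def using x by (auto intro: T.span_base)
  ultimately show ?thesis using x by (auto simp: tensor_map_def pure_tensor_def fun_eq_iff)
qed

lemma linear_on_tensor_map: "linear_on fun_scale (tensor_space s I V) fun_scale (tensor_map s I V g)"
proof -
  interpret T: vector_space "fun_scale :: 'a \<Rightarrow> ('a, 'b, 'c) tensor \<Rightarrow> _" by (rule vector_space_fun_scale)
  have "T.subspace (tensor_space s I V)" unfolding tensor_space_def by (rule T.subspace_span)
  then show ?thesis unfolding T.subspace_def
    by (auto simp: linear_on_def tensor_map_def fun_scale_def fun_eq_iff)
qed


text \<open>
  The Zariski topology on a set \<open>E\<close> whose algebra of polynomial functions is generated by a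
  set \<open>C\<close> of coordinate functions. On \<open>GL(W)\<close> the coordinates are the matrix coefficients;
  adding the inverse of the determinant to them would not change the closed sets, since the
  determinant has no zeros on \<open>GL(W)\<close>. The coordinates on a product are those of the factors.
\<close>

inductive_set poly_funs :: "('x \<Rightarrow> 'k::field) set \<Rightarrow> ('x \<Rightarrow> 'k) set" for C where
  const: "(\<lambda>_. c) \<in> poly_funs C"
| coord: "p \<in> C \<Longrightarrow> p \<in> poly_funs C"
| add: "p \<in> poly_funs C \<Longrightarrow> q \<in> poly_funs C \<Longrightarrow> (\<lambda>x. p x + q x) \<in> poly_funs C"
| mult: "p \<in> poly_funs C \<Longrightarrow> q \<in> poly_funs C \<Longrightarrow> (\<lambda>x. p x * q x) \<in> poly_funs C"

definition zariski_closure :: "'x set \<Rightarrow> ('x \<Rightarrow> 'k::field) set \<Rightarrow> 'x set \<Rightarrow> 'x set" where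
  "zariski_closure E C S =
     {x \<in> E. \<forall>p \<in> poly_funs C. (\<forall>y\<in>S. p y = 0) \<longrightarrow> p x = 0}"

definition matrix_coeffs ::
  "('k::field \<Rightarrow> 'w::ab_group_add \<Rightarrow> 'w) \<Rightarrow> 'w set \<Rightarrow> (('w \<Rightarrow> 'w) \<Rightarrow> 'k) set" where
  "matrix_coeffs s W = {(\<lambda>g. f (g w)) | f w. f \<in> dual_space s W \<and> w \<in> W}"

definition product_coeffs ::
  "('k::field \<Rightarrow> 'w::ab_group_add \<Rightarrow> 'w) \<Rightarrow> 'i set \<Rightarrow> ('i \<Rightarrow> 'w set)
    \<Rightarrow> (('i \<Rightarrow> 'w \<Rightarrow> 'w) \<Rightarrow> 'k) set" where
  "product_coeffs s I W = {(\<lambda>g. p (g i)) | i p. i \<in> I \<and> p \<in> matrix_coeffs s (W i)}"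


text \<open>
  The group of \<open>K\<close>-points of the Zariski closure in \<open>GL(V)\<close> of the image of a representation
  \<open>r\<close> of \<open>G\<close> on \<open>V\<close>, and the Zariski closure of the image of \<open>G\<close> in the product of
  these groups for a family of representations.
\<close>

definition closure_group ::
  "('k::field \<Rightarrow> 'v::ab_group_add \<Rightarrow> 'v) \<Rightarrow> 'g monoid \<Rightarrow> 'v set \<Rightarrow> ('g \<Rightarrow> 'v \<Rightarrow> 'v)
    \<Rightarrow> (('k, 'v) ext_vector \<Rightarrow> ('k, 'v) ext_vector) monoid" where
  "closure_group s G V r =
     (let W = scalar_ext s V; GLW = GL fun_scale W
      in GLW\<lparr>carrier := zariski_closure (carrier GLW) (matrix_coeffs fun_scale W)
                          ((\<lambda>g. ext_map s V (r g)) ` carrier G)\<rparr>)"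

definition closure_in_product ::
  "('k::field \<Rightarrow> 'v::ab_group_add \<Rightarrow> 'v) \<Rightarrow> 'g monoid \<Rightarrow> 'i set \<Rightarrow> ('i \<Rightarrow> 'v set)
    \<Rightarrow> ('i \<Rightarrow> 'g \<Rightarrow> 'v \<Rightarrow> 'v) \<Rightarrow> ('i \<Rightarrow> ('k, 'v) ext_vector \<Rightarrow> ('k, 'v) ext_vector) set" where
  "closure_in_product s G I V r =
     zariski_closure
       (carrier (product_group I (\<lambda>i. closure_group s G (V i) (r i))))
       (product_coeffs fun_scale I (\<lambda>i. scalar_ext s (V i)))
       ((\<lambda>g. \<lambda>i\<in>I. ext_map s (V i) (r i g)) ` carrier G)"

definition perfect_subgroup :: "('a, 'b) monoid_scheme \<Rightarrow> 'a set \<Rightarrow> bool" where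
  "perfect_subgroup G H \<longleftrightarrow> subgroup H G \<and> derived G H = H"


text \<open>
  The Goursat datum; its third component maps a coset \<open>x H1\<close> to the coset of all \<open>y\<close> with
  \<open>(x, y) \<in> \<Gamma>\<close>. Its usual properties are \<open>goursat_datum\<close> below.
\<close>

definition goursat_datum ::
  "('a, 'c) monoid_scheme \<Rightarrow> ('b, 'd) monoid_scheme \<Rightarrow> ('a \<times> 'b) set
    \<Rightarrow> 'a set \<times> 'b set \<times> ('a set \<Rightarrow> 'b set)" where
  "goursat_datum G1 G2 \<Gamma> =
     (let H1 = {x \<in> carrier G1. (x, \<one>\<^bsub>G2\<^esub>) \<in> \<Gamma>};
          H2 = {y \<in> carrier G2. (\<one>\<^bsub>G1\<^esub>, y) \<in> \<Gamma>}
      in (H1, H2, \<lambda>C\<in>carrier (G1 Mod H1). {y \<in> carrier G2. \<exists>x\<in>C. (x, y) \<in> \<Gamma>}))"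

lemma goursat_datum:
  assumes G1: "group G1" and G2: "group G2" and sub: "subgroup \<Gamma> (G1 \<times>\<times> G2)"
    and p1: "fst ` \<Gamma> = carrier G1" and p2: "snd ` \<Gamma> = carrier G2"
    and datum: "goursat_datum G1 G2 \<Gamma> = (H1, H2, \<phi>)"
  shows "H1 \<lhd> G1" "H2 \<lhd> G2" "\<phi> \<in> iso (G1 Mod H1) (G2 Mod H2)" "H1 \<times> H2 \<subseteq> \<Gamma>"
    "\<Gamma> = {(x, y) \<in> carrier G1 \<times> carrier G2. \<phi> (H1 #>\<^bsub>G1\<^esub> x) = H2 #>\<^bsub>G2\<^esub> y}"
proof -
  interpret G1: group G1 by fact
  interpret G2: group G2 by fact
  interpret D: group "G1 \<times>\<times> G2" by (rule DirProd_group) fact+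
  have in1: "x \<in> carrier G1" and in2: "y \<in> carrier G2" if "(x, y) \<in> \<Gamma>" for x y
    using imageI[OF that, of fst] imageI[OF that, of snd] p1 p2 by auto
  have mult: "(x \<otimes>\<^bsub>G1\<^esub> x', y \<otimes>\<^bsub>G2\<^esub> y') \<in> \<Gamma>" if "(x, y) \<in> \<Gamma>" "(x', y') \<in> \<Gamma>" for x y x' y'
    using subgroup.m_closed[OF sub that] by simp
  have inv: "(inv\<^bsub>G1\<^esub> x, inv\<^bsub>G2\<^esub> y) \<in> \<Gamma>" if "(x, y) \<in> \<Gamma>" for x y
    using subgroup.m_inv_closed[OF sub that] in1[OF that] in2[OF that] G1 G2 by simp
  have one: "(\<one>\<^bsub>G1\<^esub>, \<one>\<^bsub>G2\<^esub>) \<in> \<Gamma>"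
    using subgroup.one_closed[OF sub] by simp
  have ex2: "\<exists>y. (x, y) \<in> \<Gamma>" if "x \<in> carrier G1" for x using that p1 by force
  have ex1: "\<exists>x. (x, y) \<in> \<Gamma>" if "y \<in> carrier G2" for y using that p2 by force
  have H1: "H1 = {x \<in> carrier G1. (x, \<one>\<^bsub>G2\<^esub>) \<in> \<Gamma>}"
    and H2: "H2 = {y \<in> carrier G2. (\<one>\<^bsub>G1\<^esub>, y) \<in> \<Gamma>}"
    and \<phi>: "\<phi> = (\<lambda>C\<in>carrier (G1 Mod H1). {y \<in> carrier G2. \<exists>x\<in>C. (x, y) \<in> \<Gamma>})"
    using datum by (auto simp: goursat_datum_def Let_def)
  have sg1: "subgroup H1 G1"
  proof (rule G1.subgroupI)
    show "H1 \<noteq> {}" using one H1 by auto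
    show "inv\<^bsub>G1\<^esub> a \<in> H1" if "a \<in> H1" for a using that inv[of a "\<one>\<^bsub>G2\<^esub>"] by (auto simp: H1)
    show "a \<otimes>\<^bsub>G1\<^esub> b \<in> H1" if "a \<in> H1" "b \<in> H1" for a b
      using that mult[of a "\<one>\<^bsub>G2\<^esub>" b "\<one>\<^bsub>G2\<^esub>"] by (auto simp: H1)
  qed (auto simp: H1)
  have sg2: "subgroup H2 G2"
  proof (rule G2.subgroupI)
    show "H2 \<noteq> {}" using one H2 by auto
    show "inv\<^bsub>G2\<^esub> a \<in> H2" if "a \<in> H2" for a using that inv[of "\<one>\<^bsub>G1\<^esub>" a] by (auto simp: H2)
    show "a \<otimes>\<^bsub>G2\<^esub> b \<in> H2" if "a \<in> H2" "b \<in> H2" for a b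
      using that mult[of "\<one>\<^bsub>G1\<^esub>" a "\<one>\<^bsub>G1\<^esub>" b] by (auto simp: H2)
  qed (auto simp: H2)
  show n1: "H1 \<lhd> G1" unfolding G1.normal_inv_iff
  proof (intro conjI sg1 ballI)
    fix x h assume x: "x \<in> carrier G1" and h: "h \<in> H1"
    obtain y where y: "(x, y) \<in> \<Gamma>" using ex2 x by auto
    have "(x \<otimes>\<^bsub>G1\<^esub> h \<otimes>\<^bsub>G1\<^esub> inv\<^bsub>G1\<^esub> x, y \<otimes>\<^bsub>G2\<^esub> \<one>\<^bsub>G2\<^esub> \<otimes>\<^bsub>G2\<^esub> inv\<^bsub>G2\<^esub> y) \<in> \<Gamma>"
      using h y by (intro mult inv) (auto simp: H1)
    then show "x \<otimes>\<^bsub>G1\<^esub> h \<otimes>\<^bsub>G1\<^esub> inv\<^bsub>G1\<^esub> x \<in> H1" using in1 in2[OF y] by (auto simp: H1)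
  qed
  show n2: "H2 \<lhd> G2" unfolding G2.normal_inv_iff
  proof (intro conjI sg2 ballI)
    fix y h assume y: "y \<in> carrier G2" and h: "h \<in> H2"
    obtain x where x: "(x, y) \<in> \<Gamma>" using ex1 y by auto
    have "(x \<otimes>\<^bsub>G1\<^esub> \<one>\<^bsub>G1\<^esub> \<otimes>\<^bsub>G1\<^esub> inv\<^bsub>G1\<^esub> x, y \<otimes>\<^bsub>G2\<^esub> h \<otimes>\<^bsub>G2\<^esub> inv\<^bsub>G2\<^esub> y) \<in> \<Gamma>"
      using h x by (intro mult inv) (auto simp: H2)
    then show "y \<otimes>\<^bsub>G2\<^esub> h \<otimes>\<^bsub>G2\<^esub> inv\<^bsub>G2\<^esub> y \<in> H2" using in2 in1[OF x] by (auto simp: H2)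
  qed
  have key: "\<phi> (H1 #>\<^bsub>G1\<^esub> x) = H2 #>\<^bsub>G2\<^esub> y" if xy: "(x, y) \<in> \<Gamma>" for x y
  proof -
    note x = in1[OF xy] and y = in2[OF xy]
    have "z \<in> H2 #>\<^bsub>G2\<^esub> y \<longleftrightarrow> (\<exists>x'\<in>H1 #>\<^bsub>G1\<^esub> x. (x', z) \<in> \<Gamma>)" if z: "z \<in> carrier G2" for z
    proof
      assume "z \<in> H2 #>\<^bsub>G2\<^esub> y"
      then obtain h where h: "h \<in> H2" "z = h \<otimes>\<^bsub>G2\<^esub> y" by (auto simp: r_coset_def)
      then have "(\<one>\<^bsub>G1\<^esub> \<otimes>\<^bsub>G1\<^esub> x, z) \<in> \<Gamma>" using mult[of "\<one>\<^bsub>G1\<^esub>" h x y] xy by (auto simp: H2)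
      then show "\<exists>x'\<in>H1 #>\<^bsub>G1\<^esub> x. (x', z) \<in> \<Gamma>" using x G1.rcos_self[OF x sg1] by auto
    next
      assume "\<exists>x'\<in>H1 #>\<^bsub>G1\<^esub> x. (x', z) \<in> \<Gamma>"
      then obtain h where h: "h \<in> H1" "(h \<otimes>\<^bsub>G1\<^esub> x, z) \<in> \<Gamma>" by (auto simp: r_coset_def)
      then have h': "h \<in> carrier G1" "(h, \<one>\<^bsub>G2\<^esub>) \<in> \<Gamma>" by (auto simp: H1)
      have "(h \<otimes>\<^bsub>G1\<^esub> x \<otimes>\<^bsub>G1\<^esub> inv\<^bsub>G1\<^esub> x, z \<otimes>\<^bsub>G2\<^esub> inv\<^bsub>G2\<^esub> y) \<in> \<Gamma>"
        using mult[OF h(2) inv[OF xy]] .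
      then have "(h, z \<otimes>\<^bsub>G2\<^esub> inv\<^bsub>G2\<^esub> y) \<in> \<Gamma>" using x h' by (simp add: G1.m_assoc)
      from mult[OF inv[OF h'(2)] this]
      have "(inv\<^bsub>G1\<^esub> h \<otimes>\<^bsub>G1\<^esub> h, inv\<^bsub>G2\<^esub> \<one>\<^bsub>G2\<^esub> \<otimes>\<^bsub>G2\<^esub> (z \<otimes>\<^bsub>G2\<^esub> inv\<^bsub>G2\<^esub> y)) \<in> \<Gamma>" .
      then have "z \<otimes>\<^bsub>G2\<^esub> inv\<^bsub>G2\<^esub> y \<in> H2" using h' z y by (auto simp: H2)
      moreover have "z = z \<otimes>\<^bsub>G2\<^esub> inv\<^bsub>G2\<^esub> y \<otimes>\<^bsub>G2\<^esub> y" using z y by (simp add: G2.m_assoc)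
      ultimately show "z \<in> H2 #>\<^bsub>G2\<^esub> y" by (auto simp: r_coset_def)
    qed
    moreover have "H2 #>\<^bsub>G2\<^esub> y \<subseteq> carrier G2" using G2.r_coset_subset_G[of H2 y] y H2 by auto
    moreover have "H1 #>\<^bsub>G1\<^esub> x \<in> carrier (G1 Mod H1)" using x by (auto simp: carrier_FactGroup)
    ultimately show ?thesis unfolding \<phi> by auto
  qed
  have same_coset: "(x, y') \<in> \<Gamma>" if "(x, y) \<in> \<Gamma>" "y' \<in> carrier G2" "H2 #>\<^bsub>G2\<^esub> y = H2 #>\<^bsub>G2\<^esub> y'" for x y y'
  proof -
    have "y' \<in> H2 #>\<^bsub>G2\<^esub> y" using G2.rcos_self[OF that(2) sg2] that(3) by simp
    then obtain h where "h \<in> H2" "y' = h \<otimes>\<^bsub>G2\<^esub> y" by (auto simp: r_coset_def)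
    then show ?thesis using mult[of "\<one>\<^bsub>G1\<^esub>" h x y] that(1) in1[OF that(1)] by (auto simp: H2)
  qed
  show "\<phi> \<in> iso (G1 Mod H1) (G2 Mod H2)"
  proof (rule isoI)
    show "\<phi> \<in> hom (G1 Mod H1) (G2 Mod H2)"
    proof (rule homI)
      fix C assume "C \<in> carrier (G1 Mod H1)"
      then obtain x where "x \<in> carrier G1" "C = H1 #>\<^bsub>G1\<^esub> x" by (auto simp: carrier_FactGroup)
      then show "\<phi> C \<in> carrier (G2 Mod H2)" using ex2[of x] key[of x] in2 by (auto simp: carrier_FactGroup)
    next
      fix C D assume "C \<in> carrier (G1 Mod H1)" "D \<in> carrier (G1 Mod H1)"
      then obtain x x' where x: "x \<in> carrier G1" "C = H1 #>\<^bsub>G1\<^esub> x" "x' \<in> carrier G1" "D = H1 #>\<^bsub>G1\<^esub> x'"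
        by (auto simp: carrier_FactGroup)
      then obtain y y' where y: "(x, y) \<in> \<Gamma>" "(x', y') \<in> \<Gamma>" using ex2 by blast
      show "\<phi> (C \<otimes>\<^bsub>G1 Mod H1\<^esub> D) = \<phi> C \<otimes>\<^bsub>G2 Mod H2\<^esub> \<phi> D"
        using key[OF y(1)] key[OF y(2)] key[OF mult[OF y]] x in2[OF y(1)] in2[OF y(2)]
        by (simp add: normal.rcos_sum[OF n1] normal.rcos_sum[OF n2])
    qed
    show "bij_betw \<phi> (carrier (G1 Mod H1)) (carrier (G2 Mod H2))"
      unfolding bij_betw_def
    proof
      show "inj_on \<phi> (carrier (G1 Mod H1))"
      proof (rule inj_onI)
        fix C D assume C: "C \<in> carrier (G1 Mod H1)" "D \<in> carrier (G1 Mod H1)" and eq: "\<phi> C = \<phi> D"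
        then obtain x x' where x: "x \<in> carrier G1" "C = H1 #>\<^bsub>G1\<^esub> x" "x' \<in> carrier G1" "D = H1 #>\<^bsub>G1\<^esub> x'"
          by (auto simp: carrier_FactGroup)
        then obtain y y' where y: "(x, y) \<in> \<Gamma>" "(x', y') \<in> \<Gamma>" using ex2 by blast
        then have "(x, y') \<in> \<Gamma>" using same_coset[of x y y'] key[OF y(1)] key[OF y(2)] eq x in2[OF y(2)] by simp
        then have "(x' \<otimes>\<^bsub>G1\<^esub> inv\<^bsub>G1\<^esub> x, y' \<otimes>\<^bsub>G2\<^esub> inv\<^bsub>G2\<^esub> y') \<in> \<Gamma>" by (rule mult[OF y(2) inv])
        then have "x' \<otimes>\<^bsub>G1\<^esub> inv\<^bsub>G1\<^esub> x \<in> H1" using x in2[OF y(2)] by (simp add: H1)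
        moreover have "x' = x' \<otimes>\<^bsub>G1\<^esub> inv\<^bsub>G1\<^esub> x \<otimes>\<^bsub>G1\<^esub> x" using x by (simp add: G1.m_assoc)
        ultimately have "x' \<in> H1 #>\<^bsub>G1\<^esub> x" by (auto simp: r_coset_def)
        then show "C = D" using G1.repr_independence x sg1 by metis
      qed
      show "\<phi> ` carrier (G1 Mod H1) = carrier (G2 Mod H2)"
      proof
        show "\<phi> ` carrier (G1 Mod H1) \<subseteq> carrier (G2 Mod H2)"
        proof
          fix D assume "D \<in> \<phi> ` carrier (G1 Mod H1)"
          then obtain x where "x \<in> carrier G1" "D = \<phi> (H1 #>\<^bsub>G1\<^esub> x)" by (auto simp: carrier_FactGroup)
          then show "D \<in> carrier (G2 Mod H2)" using ex2[of x] key[of x] in2 by (auto simp: carrier_FactGroup)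
        qed
        show "carrier (G2 Mod H2) \<subseteq> \<phi> ` carrier (G1 Mod H1)"
        proof
          fix D assume "D \<in> carrier (G2 Mod H2)"
          then obtain y where y: "y \<in> carrier G2" "D = H2 #>\<^bsub>G2\<^esub> y" by (auto simp: carrier_FactGroup)
          then obtain x where x: "(x, y) \<in> \<Gamma>" using ex1 by blast
          then have "D = \<phi> (H1 #>\<^bsub>G1\<^esub> x)" using key y by simp
          then show "D \<in> \<phi> ` carrier (G1 Mod H1)" using in1[OF x] by (auto simp: carrier_FactGroup)
        qed
      qed
    qed
  qed
  show "H1 \<times> H2 \<subseteq> \<Gamma>"
  proof clarify
    fix x y assume "x \<in> H1" "y \<in> H2"
    then show "(x, y) \<in> \<Gamma>" using mult[of x "\<one>\<^bsub>G2\<^esub>" "\<one>\<^bsub>G1\<^esub>" y] by (auto simp: H1 H2)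
  qed
  show "\<Gamma> = {(x, y) \<in> carrier G1 \<times> carrier G2. \<phi> (H1 #>\<^bsub>G1\<^esub> x) = H2 #>\<^bsub>G2\<^esub> y}"
  proof (intro equalityI subsetI)
    fix z assume "z \<in> \<Gamma>"
    then show "z \<in> {(x, y) \<in> carrier G1 \<times> carrier G2. \<phi> (H1 #>\<^bsub>G1\<^esub> x) = H2 #>\<^bsub>G2\<^esub> y}"
      using key in1 in2 by (cases z) auto
  next
    fix z assume "z \<in> {(x, y) \<in> carrier G1 \<times> carrier G2. \<phi> (H1 #>\<^bsub>G1\<^esub> x) = H2 #>\<^bsub>G2\<^esub> y}"
    then obtain x y where z: "z = (x, y)" "x \<in> carrier G1" "y \<in> carrier G2" "\<phi> (H1 #>\<^bsub>G1\<^esub> x) = H2 #>\<^bsub>G2\<^esub> y"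
      by auto
    obtain y' where "(x, y') \<in> \<Gamma>" using ex2 z(2) by blast
    then show "z \<in> \<Gamma>" using same_coset[of x y' y] key[of x y'] z by simp
  qed
qed

text \<open>
  The first component of the Goursat datum of the image of the Zariski closure in the product of
  the closure groups with indices \<open>i\<close> and \<open>j\<close>.
\<close>

definition goursat_kernel ::
  "('k::field \<Rightarrow> 'v::ab_group_add \<Rightarrow> 'v) \<Rightarrow> 'g monoid \<Rightarrow> 'i set \<Rightarrow> ('i \<Rightarrow> 'v set)
    \<Rightarrow> ('i \<Rightarrow> 'g \<Rightarrow> 'v \<Rightarrow> 'v) \<Rightarrow> 'i \<Rightarrow> 'i \<Rightarrow> (('k, 'v) ext_vector \<Rightarrow> ('k, 'v) ext_vector) set" where
  "goursat_kernel s G I V r i j =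
     fst (goursat_datum (closure_group s G (V i) (r i)) (closure_group s G (V j) (r j))
            ((\<lambda>g. (g i, g j)) ` closure_in_product s G I V r))"

end

theory Submission
  imports Defs
begin

text \<open>
  Let \<open>i\<close> be an index such that \<open>N i\<close> lies in \<open>H i j\<close> for all \<open>j \<noteq> i\<close>; the coinvariants of the
  tensor product then vanish. A nonzero coinvariant would be detected by a linear form on the
  tensor product, that is, by a nonzero \<open>G\<close>-invariant multilinear form \<open>b\<close> on the \<open>V j\<close>
  (\<open>tensor_coinvariants_zero\<close>), so it is enough to show that such a \<open>b\<close> is zero.

  Over the algebraic closure, \<open>b\<close> extends to a multilinear form \<open>B\<close> whose values on translates
  of a fixed tuple are polynomial in the translating element (\<open>multilinear_form_scalar_ext\<close>).
  Invariance of \<open>B\<close> under the image of \<open>G\<close> is therefore a polynomial condition and passes to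
  the Zariski closure (\<open>closure_stabilizes_form\<close>). Let \<open>\<Gamma>\<close> be the stabilizer of \<open>B\<close> in the
  product of the closure groups. Working with \<open>\<Gamma>\<close> instead of the closure itself has the
  advantage that it is visibly a subgroup (\<open>stabilizer_subgroup\<close>).

  By the choice of \<open>i\<close>, for every \<open>j \<noteq> i\<close> each \<open>n \<in> N i\<close> is the \<open>i\<close>-th component of an element
  of \<open>\<Gamma>\<close> with trivial \<open>j\<close>-th component. The commutator of an element that is trivial at \<open>j\<close>
  and one that is trivial at \<open>j'\<close> is trivial at both places; as \<open>N i\<close> is perfect, the elements
  with \<open>i\<close>-th component \<open>n\<close> and all other components trivial belong to \<open>\<Gamma>\<close>
  (\<open>perfect_subgroup_lift\<close>). Hence \<open>B\<close>, as a linear form in its \<open>i\<close>-th argument, is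
  \<open>N i\<close>-invariant, and it is zero because \<open>N i\<close> has no coinvariants
  (\<open>invariant_multilinear_form_eq_0\<close>).
\<close>

section \<open>Linear and multilinear maps on subspaces\<close>

lemma linear_on_zero:
  assumes "vector_space s" "Modules.module.subspace s V" "linear_on s V t f"
  shows "f 0 = 0"
proof -
  interpret vector_space s by fact
  show ?thesis using assms(2,3) unfolding linear_on_def
    by (metis add_0 add_left_cancel add.right_neutral subspace_0)
qed

lemma linear_on_eq_on_span:
  assumes s: "vector_space s" and f: "linear_on s (Modules.module.span s A) t f"
    and g: "linear_on s (Modules.module.span s A) t g"
    and eq: "\<And>a. a \<in> A \<Longrightarrow> f a = g a" and v: "v \<in> Modules.module.span s A"
  shows "f v = g v"
proof -
  interpret vector_space s by fact
  have "v \<in> span A \<and> f v = g v" using v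
  proof (induction rule: span_induct_alt)
    case base
    show ?case using linear_on_zero[OF s subspace_span f] linear_on_zero[OF s subspace_span g]
      by (simp add: span_zero)
  next
    case (step c x y)
    have x: "x \<in> span A" using step(1) by (rule span_base)
    then have "s c x \<in> span A" by (rule span_scale)
    then show ?case using f g x step eq by (simp add: linear_on_def span_add)
  qed
  then show ?thesis ..
qed

lemma linear_on_image_span:
  assumes s: "vector_space s" and t: "vector_space t"
    and f: "linear_on s (Modules.module.span s A) t f"
    and A: "f ` A \<subseteq> U" and U: "Modules.module.subspace t U"
    and v: "v \<in> Modules.module.span s A"
  shows "f v \<in> U"
proof -
  interpret vector_space s by fact
  interpret t: vector_space t by fact
  have "v \<in> span A \<and> f v \<in> U" using v
  proof (induction rule: span_induct_alt)
    case base
    show ?case using linear_on_zero[OF s subspace_span f] U by (simp add: t.subspace_0 span_zero)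
  next
    case (step c x y)
    have x: "x \<in> span A" using step(1) by (rule span_base)
    then have "s c x \<in> span A" by (rule span_scale)
    moreover have "f x \<in> U" using A step(1) by auto
    ultimately show ?case using f x step U
      by (simp add: linear_on_def t.subspace_add t.subspace_scale span_add)
  qed
  then show ?thesis ..
qed

lemma PiE_upd: "x \<in> Pi\<^sub>E I V \<Longrightarrow> i \<in> I \<Longrightarrow> v \<in> V i \<Longrightarrow> x(i := v) \<in> Pi\<^sub>E I V"
  by (auto simp: PiE_iff extensional_def)

text \<open>Multilinear maps that agree on tuples from spanning sets agree; the spanning sets are
  replaced by the whole spaces one coordinate at a time.\<close>

lemma multilinear_on_eqI:
  assumes s: "vector_space s" and "finite I"
    and span: "\<And>i. i \<in> I \<Longrightarrow> V i = Modules.module.span s (A i)"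
    and F: "multilinear_on s I V t F" and F': "multilinear_on s I V t F'"
    and eq: "\<And>x. x \<in> Pi\<^sub>E I A \<Longrightarrow> F x = F' x"
    and x: "x \<in> Pi\<^sub>E I V"
  shows "F x = F' x"
proof -
  interpret vector_space s by fact
  have AV: "A i \<subseteq> V i" if "i \<in> I" for i using span[OF that] span_superset by auto
  have "\<forall>x \<in> (\<Pi>\<^sub>E i\<in>I. if i \<in> J then V i else A i). F x = F' x" if "J \<subseteq> I" "finite J" for J
    using that(2,1)
  proof (induction J rule: finite_induct)
    case empty then show ?case using eq by simp
  next
    case (insert j J)
    show ?case
    proof
      fix x assume x: "x \<in> (\<Pi>\<^sub>E i\<in>I. if i \<in> insert j J then V i else A i)"
      have j: "j \<in> I" using insert by auto
      have xV: "x \<in> Pi\<^sub>E I V" using x AV by (fastforce simp: PiE_iff split: if_splits)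
      have "F (x(j := x j)) = F' (x(j := x j))"
      proof (rule linear_on_eq_on_span[OF s, of "A j" t "\<lambda>v. F (x(j := v))" "\<lambda>v. F' (x(j := v))"])
        show "linear_on s (span (A j)) t (\<lambda>v. F (x(j := v)))"
          "linear_on s (span (A j)) t (\<lambda>v. F' (x(j := v)))"
          using F F' xV j span by (auto simp: multilinear_on_def)
        show "x j \<in> span (A j)" using xV j span by (auto simp: PiE_iff)
        fix a assume "a \<in> A j"
        then have "x(j := a) \<in> (\<Pi>\<^sub>E i\<in>I. if i \<in> J then V i else A i)"
          using x j insert(2) by (auto simp: PiE_iff extensional_def)
        then show "F (x(j := a)) = F' (x(j := a))" using insert by auto
      qed
      then show "F x = F' x" by simp
    qed
  qed
  from this[of I] x \<open>finite I\<close> show ?thesis by (auto cong: PiE_cong)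
qed

text \<open>The map \<open>\<iota>\<close> on scalars makes the lemma applicable to maps, such as \<open>ext_vec\<close>, that are
  linear over a subfield of the scalars of their target.\<close>

lemma multilinear_on_compose:
  assumes F: "multilinear_on s' I V' t F"
    and f: "\<And>i. i \<in> I \<Longrightarrow> linear_on s (V i) (\<lambda>c. s' (\<iota> c)) (f i)" "\<And>i. i \<in> I \<Longrightarrow> f i ` V i \<subseteq> V' i"
  shows "multilinear_on s I V (\<lambda>c. t (\<iota> c)) (\<lambda>x. F (\<lambda>i\<in>I. f i (x i)))"
  unfolding multilinear_on_def
proof (intro ballI)
  fix x i assume xi: "x \<in> Pi\<^sub>E I V" "i \<in> I"
  define y where "y = (\<lambda>i\<in>I. f i (x i))"
  have y: "y \<in> Pi\<^sub>E I V'" using xi f(2) by (fastforce simp: y_def PiE_iff)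
  have eq: "(\<lambda>j\<in>I. f j ((x(i := v)) j)) = y(i := f i v)" for v
    using xi by (auto simp: y_def fun_eq_iff)
  have "linear_on s' (V' i) t (\<lambda>v. F (y(i := v)))"
    using F y xi by (auto simp: multilinear_on_def)
  then show "linear_on s (V i) (\<lambda>c. t (\<iota> c)) (\<lambda>v. F (\<lambda>j\<in>I. f j ((x(i := v)) j)))"
    unfolding eq using f(1)[OF xi(2)] f(2)[OF xi(2)]
    unfolding linear_on_def image_subset_iff by simp
qed

lemma separating_linear_form:
  assumes "vector_space (s :: 'k::field \<Rightarrow> 'v::ab_group_add \<Rightarrow> 'v)" "Modules.module.subspace s U" "u \<notin> U"
  shows "\<exists>f. Vector_Spaces.linear s (*) f \<and> (\<forall>x\<in>U. f x = 0) \<and> f u \<noteq> 0"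
proof -
  have "vector_space ((*) :: 'k \<Rightarrow> 'k \<Rightarrow> 'k)" by unfold_locales (auto simp: algebra_simps)
  then interpret p: vector_space_pair s "(*) :: 'k \<Rightarrow> 'k \<Rightarrow> 'k"
    using assms(1) by (simp add: vector_space_pair_def)
  obtain B where B: "B \<subseteq> U" "p.vs1.independent B" "U \<subseteq> p.vs1.span B"
    using p.vs1.maximal_independent_subset by metis
  have "p.vs1.span B \<subseteq> U" using B(1) assms(2) by (rule p.vs1.span_minimal)
  then have "u \<notin> p.vs1.span B" using assms(3) by auto
  then have ind: "p.vs1.independent (insert u B)" using B(2) by (rule p.vs1.independent_insertI)
  define f where "f = p.construct (insert u B) (\<lambda>b. if b = u then 1 else 0)"
  have lin: "Vector_Spaces.linear s (*) f" unfolding f_def by (rule p.linear_construct[OF ind])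
  have f: "f b = (if b = u then 1 else 0)" if "b \<in> insert u B" for b
    unfolding f_def by (rule p.construct_basis[OF ind that])
  have "f x = 0" if "x \<in> U" for x
  proof (rule p.linear_eq_0_on_span[OF lin])
    show "x \<in> p.vs1.span B" using that B(3) by auto
    show "f b = 0" if "b \<in> B" for b using f that B(1) assms(3) by auto
  qed
  with lin f show ?thesis by (intro exI[of _ f]) auto
qed


section \<open>Extension of multilinear forms to the algebraic closure\<close>

lemma poly_funs_sum: "finite A \<Longrightarrow> (\<And>a. a \<in> A \<Longrightarrow> p a \<in> poly_funs C) \<Longrightarrow> (\<lambda>x. \<Sum>a\<in>A. p a x) \<in> poly_funs C"
  by (induction A rule: finite_induct) (auto intro: poly_funs.intros)

lemma poly_funs_prod: "finite A \<Longrightarrow> (\<And>a. a \<in> A \<Longrightarrow> p a \<in> poly_funs C) \<Longrightarrow> (\<lambda>x. \<Prod>a\<in>A. p a x) \<in> poly_funs C"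
  by (induction A rule: finite_induct) (auto intro: poly_funs.intros)

lemma fin_dim_dual_basis:
  assumes s: "vector_space s" and V: "fin_dim_subspace s V"
  shows "\<exists>B d. finite B \<and> Modules.module.span s B = V \<and>
    (\<forall>b. d b \<in> dual_space s V) \<and> (\<forall>b\<in>B. \<forall>b'\<in>B. d b b' = (if b = b' then 1 else 0))"
proof -
  interpret s: vector_space s by fact
  from V obtain A where A: "finite A" "s.span A = V" unfolding fin_dim_subspace_def by auto
  obtain B where B: "B \<subseteq> A" "s.independent B" "A \<subseteq> s.span B"
    using s.maximal_independent_subset by metis
  have spB: "s.span B = V" using B A by (metis s.span_eq s.span_mono s.span_span)
  have finB: "finite B" using A B finite_subset by auto
  define d where "d b x = s.representation B x b" for b x
  have "d b x = 0" if "x \<notin> V" for b x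
    using that spB by (simp add: d_def s.representation_def)
  then have d: "d b \<in> dual_space s V" for b
    using spB by (auto simp: dual_space_def linear_on_def d_def s.representation_add[OF B(2)] s.representation_scale[OF B(2)])
  have "d b b' = (if b = b' then 1 else 0)" if "b \<in> B" "b' \<in> B" for b b'
    using that by (simp add: d_def s.representation_basis[OF B(2)])
  with finB spB d show ?thesis by blast
qed

lemma coordinate_in_dual_space:
  fixes s :: "'k::field \<Rightarrow> 'v::ab_group_add \<Rightarrow> 'v"
  shows "(\<lambda>w. if w \<in> scalar_ext s V then w d else 0) \<in> dual_space fun_scale (scalar_ext s V)"
proof -
  interpret K: vector_space "fun_scale :: 'k alg_closure \<Rightarrow> ('k, 'v) ext_vector \<Rightarrow> _" by (rule vector_space_fun_scale)
  have "K.subspace (scalar_ext s V)" unfolding scalar_ext_def by (rule K.subspace_span)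
  then show ?thesis unfolding K.subspace_def by (auto simp: dual_space_def linear_on_def fun_scale_def)
qed

text \<open>
  The multilinear extension of \<open>b\<close> to the spaces \<open>scalar_ext s (V i)\<close>. Since the elements of
  \<open>scalar_ext s (V i)\<close> are functions on the dual space, the coordinate of \<open>w\<close> at a basis vector
  is the value of \<open>w\<close> at the corresponding vector \<open>d\<close> of the dual basis, and \<open>B\<close> can be written down
  in these coordinates. The last part of the conclusion says that \<open>B (g w)\<close> is a polynomial
  in \<open>g\<close>.
\<close>

lemma multilinear_form_scalar_ext:
  fixes s :: "'k::field \<Rightarrow> 'v::ab_group_add \<Rightarrow> 'v"
  assumes s: "vector_space s" and I: "finite I" and V: "\<And>i. i \<in> I \<Longrightarrow> fin_dim_subspace s (V i)"
    and b: "b \<in> multilinear_forms s I V"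
  defines "W \<equiv> \<lambda>i. scalar_ext s (V i)"
  shows "\<exists>B. multilinear_on fun_scale I W (*) B \<and>
     (\<forall>x\<in>Pi\<^sub>E I V. B (\<lambda>i\<in>I. ext_vec s (V i) (x i)) = to_ac (b x)) \<and>
     (\<forall>w\<in>Pi\<^sub>E I W. \<exists>p\<in>poly_funs (product_coeffs fun_scale I W).
        \<forall>g. (\<forall>i\<in>I. g i (w i) \<in> W i) \<longrightarrow> p g = B (\<lambda>i\<in>I. g i (w i)))"
proof -
  have sub: "Modules.module.subspace s (V i)" if "i \<in> I" for i
    using V[OF that] by (simp add: fin_dim_subspace_def)
  have "\<forall>i\<in>I. \<exists>A. \<exists>d. finite A \<and> Modules.module.span s A = V i \<and>
    (\<forall>b. d b \<in> dual_space s (V i)) \<and> (\<forall>b\<in>A. \<forall>b'\<in>A. d b b' = (if b = b' then 1 else 0))"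
    using fin_dim_dual_basis[OF s V] by blast
  from bchoice[OF this] obtain A where "\<forall>i\<in>I. \<exists>d. finite (A i) \<and> Modules.module.span s (A i) = V i \<and>
    (\<forall>b. d b \<in> dual_space s (V i)) \<and>
    (\<forall>b\<in>A i. \<forall>b'\<in>A i. d b b' = (if b = b' then 1 else 0))" ..
  from bchoice[OF this] obtain d where "\<forall>i\<in>I. finite (A i) \<and> Modules.module.span s (A i) = V i \<and>
    (\<forall>b. d i b \<in> dual_space s (V i)) \<and>
    (\<forall>b\<in>A i. \<forall>b'\<in>A i. d i b b' = (if b = b' then 1 else 0))" ..
  then have A: "\<And>i. i \<in> I \<Longrightarrow> finite (A i)" "\<And>i. i \<in> I \<Longrightarrow> V i = Modules.module.span s (A i)"
    and d: "\<And>i a. i \<in> I \<Longrightarrow> d i a \<in> dual_space s (V i)"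
    and delta: "\<And>i a a'. i \<in> I \<Longrightarrow> a \<in> A i \<Longrightarrow> a' \<in> A i \<Longrightarrow> d i a a' = (if a = a' then 1 else 0)"
    by simp_all
  interpret s: vector_space s by fact
  have AV: "A i \<subseteq> V i" if "i \<in> I" for i using A(2)[OF that] s.span_superset by auto
  have finE: "finite (Pi\<^sub>E I A)" using I A(1) by (simp add: finite_PiE)
  define B where "B w = (\<Sum>e\<in>Pi\<^sub>E I A. (\<Prod>i\<in>I. w i (d i (e i))) * to_ac (b e))" for w
  have mB: "multilinear_on fun_scale I W (*) B"
    unfolding multilinear_on_def
  proof (intro ballI)
    fix w i assume w: "w \<in> Pi\<^sub>E I W" and i: "i \<in> I"
    have "B (w(i := v)) = (\<Sum>e\<in>Pi\<^sub>E I A. v (d i (e i)) * ((\<Prod>j\<in>I - {i}. w j (d j (e j))) * to_ac (b e)))" for v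
      unfolding B_def using I i by (subst prod.remove[of I i]) (auto simp: mult.assoc intro!: sum.cong)
    then show "linear_on fun_scale (W i) (*) (\<lambda>v. B (w(i := v)))"
      by (simp add: linear_on_def fun_scale_def sum.distrib distrib_right sum_distrib_left mult.assoc)
  qed
  have "B (\<lambda>i\<in>I. ext_vec s (V i) (x i)) = to_ac (b x)" if x: "x \<in> Pi\<^sub>E I V" for x
  proof (rule multilinear_on_eqI[OF s I A(2), where t = "\<lambda>c. (*) (to_ac c)"
        and F = "\<lambda>x. B (\<lambda>i\<in>I. ext_vec s (V i) (x i))" and F' = "\<lambda>x. to_ac (b x)"])
    show "multilinear_on s I V (\<lambda>c. (*) (to_ac c)) (\<lambda>x. B (\<lambda>i\<in>I. ext_vec s (V i) (x i)))"
    proof (rule multilinear_on_compose[OF mB])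
      fix i assume i: "i \<in> I"
      show "linear_on s (V i) (\<lambda>c. fun_scale (to_ac c)) (ext_vec s (V i))"
        by (rule linear_on_ext_vec[OF s sub[OF i]])
      interpret K: vector_space "fun_scale :: 'k alg_closure \<Rightarrow> ('k, 'v) ext_vector \<Rightarrow> _" by (rule vector_space_fun_scale)
      show "ext_vec s (V i) ` V i \<subseteq> W i"
        unfolding W_def scalar_ext_def by (rule K.span_superset)
    qed
    show "multilinear_on s I V (\<lambda>c. (*) (to_ac c)) (\<lambda>x. to_ac (b x))"
      using b by (simp add: multilinear_forms_def multilinear_on_def linear_on_def)
    fix x assume x: "x \<in> Pi\<^sub>E I A"
    have "B (\<lambda>i\<in>I. ext_vec s (V i) (x i)) = (\<Sum>e\<in>Pi\<^sub>E I A. (if e = x then to_ac (b e) else 0))"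
      unfolding B_def
    proof (rule sum.cong[OF refl])
      fix e assume e: "e \<in> Pi\<^sub>E I A"
      have "(\<Prod>i\<in>I. (\<lambda>i\<in>I. ext_vec s (V i) (x i)) i (d i (e i))) = (\<Prod>i\<in>I. if e i = x i then 1 else 0)"
        using e x d delta by (intro prod.cong) (auto simp: ext_vec_def PiE_iff)
      also have "\<dots> = (if e = x then 1 else 0)"
      proof (cases "e = x")
        case False
        then obtain i where "i \<in> I" "e i \<noteq> x i" using PiE_ext[OF e x] by blast
        then show ?thesis using I False by (auto intro!: prod_zero)
      qed simp
      finally show "(\<Prod>i\<in>I. (\<lambda>i\<in>I. ext_vec s (V i) (x i)) i (d i (e i))) * to_ac (b e) = (if e = x then to_ac (b e) else 0)"
        by simp
    qed
    then show "B (\<lambda>i\<in>I. ext_vec s (V i) (x i)) = to_ac (b x)" using finE x by simp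
  qed (use x in auto)
  moreover have "\<exists>p\<in>poly_funs (product_coeffs fun_scale I W).
        \<forall>g. (\<forall>i\<in>I. g i (w i) \<in> W i) \<longrightarrow> p g = B (\<lambda>i\<in>I. g i (w i))" if w: "w \<in> Pi\<^sub>E I W" for w
  proof
    \<comment> \<open>coordinates, cut off outside the space as the linear forms in \<open>dual_space\<close> are\<close>
    let ?f = "\<lambda>i a w. if w \<in> W i then w (d i a) else 0"
    let ?p = "\<lambda>g. \<Sum>e\<in>Pi\<^sub>E I A. (\<Prod>i\<in>I. ?f i (e i) (g i (w i))) * to_ac (b e)"
    show "\<forall>g. (\<forall>i\<in>I. g i (w i) \<in> W i) \<longrightarrow> ?p g = B (\<lambda>i\<in>I. g i (w i))"
      by (simp add: B_def)
    have "(\<lambda>g. ?f i (e i) (g i (w i))) \<in> product_coeffs fun_scale I W" if i: "i \<in> I" for i e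
    proof -
      have "?f i (e i) \<in> dual_space fun_scale (W i)" unfolding W_def by (rule coordinate_in_dual_space)
      then have "(\<lambda>h. ?f i (e i) (h (w i))) \<in> matrix_coeffs fun_scale (W i)"
        unfolding matrix_coeffs_def using w i
        by (intro CollectI exI[of _ "?f i (e i)"] exI[of _ "w i"]) auto
      then show ?thesis unfolding product_coeffs_def using i
        by (intro CollectI exI[of _ i] exI[of _ "\<lambda>h. ?f i (e i) (h (w i))"]) auto
    qed
    then show "?p \<in> poly_funs (product_coeffs fun_scale I W)"
      by (intro poly_funs_sum poly_funs_prod poly_funs.mult poly_funs.const poly_funs.coord finE I)
  qed
  ultimately show ?thesis using mB by blast
qed


section \<open>Lifts of perfect subgroups to a subgroup of a product\<close>

text \<open>
  If each element of a perfect subgroup \<open>N\<close> of the \<open>i\<close>-th factor lifts to \<open>\<Gamma>\<close> with trivial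
  component at any single place \<open>j \<in> J\<close>, then it lifts with trivial components at all these
  places simultaneously. The hypothesis \<open>base\<close> is needed only for empty \<open>J\<close>.
\<close>

lemma perfect_subgroup_lift:
  assumes grp: "\<And>k. k \<in> I \<Longrightarrow> group (Gr k)" and \<Gamma>: "subgroup \<Gamma> (product_group I Gr)"
    and i: "i \<in> I" and N: "perfect_subgroup (Gr i) N"
    and base: "\<And>n. n \<in> N \<Longrightarrow> \<exists>g\<in>\<Gamma>. g i = n"
    and pair: "\<And>n j. n \<in> N \<Longrightarrow> j \<in> J \<Longrightarrow> \<exists>g\<in>\<Gamma>. g i = n \<and> g j = \<one>\<^bsub>Gr j\<^esub>"
    and J: "finite J" "J \<subseteq> I"
    and n: "n \<in> N"
  shows "\<exists>g\<in>\<Gamma>. g i = n \<and> (\<forall>j\<in>J. g j = \<one>\<^bsub>Gr j\<^esub>)"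
proof -
  interpret P: group "product_group I Gr" using grp by simp
  interpret i: group "Gr i" using grp i .
  have \<Gamma>_carr: "g \<in> (\<Pi>\<^sub>E k\<in>I. carrier (Gr k))" if "g \<in> \<Gamma>" for g
    using subgroup.subset[OF \<Gamma>] that by auto
  have mult: "(\<lambda>k\<in>I. g k \<otimes>\<^bsub>Gr k\<^esub> h k) \<in> \<Gamma>" if "g \<in> \<Gamma>" "h \<in> \<Gamma>" for g h
    using subgroup.m_closed[OF \<Gamma> that] by simp
  have inv: "(\<lambda>k\<in>I. inv\<^bsub>Gr k\<^esub> g k) \<in> \<Gamma>" if "g \<in> \<Gamma>" for g
    using subgroup.m_inv_closed[OF \<Gamma> that] \<Gamma>_carr[OF that] grp by simp
  have one: "(\<lambda>k\<in>I. \<one>\<^bsub>Gr k\<^esub>) \<in> \<Gamma>" using subgroup.one_closed[OF \<Gamma>] by simp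
  define M where "M J = {n. \<exists>g\<in>\<Gamma>. g i = n \<and> (\<forall>j\<in>J. g j = \<one>\<^bsub>Gr j\<^esub>)}" for J
  have M_sub: "subgroup (M J) (Gr i)" if J: "J \<subseteq> I" for J
  proof (rule i.subgroupI)
    show "M J \<subseteq> carrier (Gr i)" using \<Gamma>_carr i by (fastforce simp: M_def)
    have "(\<lambda>k\<in>I. \<one>\<^bsub>Gr k\<^esub>) i \<in> M J" unfolding M_def using J
      by (intro CollectI bexI[OF _ one]) auto
    then show "M J \<noteq> {}" by auto
    have one_k: "monoid (Gr k)" if "k \<in> J" for k using grp J that by (auto intro: group.is_monoid)
    fix a assume "a \<in> M J"
    then obtain g where g: "g \<in> \<Gamma>" "g i = a" "\<forall>j\<in>J. g j = \<one>\<^bsub>Gr j\<^esub>" by (auto simp: M_def)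
    have "\<forall>j\<in>J. inv\<^bsub>Gr j\<^esub> g j = \<one>\<^bsub>Gr j\<^esub>" using g(3) one_k by (simp add: monoid.inv_one)
    then show "inv\<^bsub>Gr i\<^esub> a \<in> M J" using inv[OF g(1)] g(2) i J
      by (auto simp: M_def subset_iff intro!: bexI[OF _ inv[OF g(1)]])
    fix b assume "b \<in> M J"
    then obtain h where h: "h \<in> \<Gamma>" "h i = b" "\<forall>j\<in>J. h j = \<one>\<^bsub>Gr j\<^esub>" by (auto simp: M_def)
    show "a \<otimes>\<^bsub>Gr i\<^esub> b \<in> M J" using g h i J one_k
      by (auto simp: M_def subset_iff intro!: bexI[OF _ mult[OF g(1) h(1)]])
  qed
  have "J' \<subseteq> J \<Longrightarrow> N \<subseteq> M J'" if "finite J'" for J'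
    using that
  proof (induction J' rule: finite_induct)
    case empty
    then show ?case using base by (auto simp: M_def)
  next
    case (insert j J')
    have j: "j \<in> I" "j \<in> J" "J' \<subseteq> I" using insert.prems J by auto
    interpret j: group "Gr j" using grp j(1) .
    have NC: "N \<subseteq> carrier (Gr i)" using N by (auto simp: perfect_subgroup_def dest: subgroup.subset)
    have comm: "a \<otimes>\<^bsub>Gr i\<^esub> b \<otimes>\<^bsub>Gr i\<^esub> inv\<^bsub>Gr i\<^esub> a \<otimes>\<^bsub>Gr i\<^esub> inv\<^bsub>Gr i\<^esub> b \<in> M (insert j J')"
      if ab: "a \<in> N" "b \<in> N" for a b
    proof -
      \<comment> \<open>\<open>g\<close> is trivial on \<open>J'\<close> and \<open>h\<close> is trivial at \<open>j\<close>, so that their commutator \<open>c\<close> is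
        trivial on both\<close>
      from insert have "a \<in> M J'" using ab by auto
      then obtain g where g: "g \<in> \<Gamma>" "g i = a" "\<forall>j\<in>J'. g j = \<one>\<^bsub>Gr j\<^esub>" by (auto simp: M_def)
      obtain h where h: "h \<in> \<Gamma>" "h i = b" "h j = \<one>\<^bsub>Gr j\<^esub>" using pair[OF ab(2) j(2)] by auto
      define c where "c k = g k \<otimes>\<^bsub>Gr k\<^esub> h k \<otimes>\<^bsub>Gr k\<^esub> inv\<^bsub>Gr k\<^esub> g k \<otimes>\<^bsub>Gr k\<^esub> inv\<^bsub>Gr k\<^esub> h k" for k
      have "restrict c I \<in> \<Gamma>"
        using mult[OF mult[OF mult[OF g(1) h(1)] inv[OF g(1)]] inv[OF h(1)]]
        unfolding c_def by (rule back_subst[of "\<lambda>x. x \<in> \<Gamma>"]) (simp cong: restrict_cong)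
      moreover have "c j = \<one>\<^bsub>Gr j\<^esub>"
        using h(3) \<Gamma>_carr[OF g(1)] j(1) by (auto simp: c_def PiE_iff)
      moreover have "c k = \<one>\<^bsub>Gr k\<^esub>" if k: "k \<in> J'" for k
      proof -
        interpret k: group "Gr k" using grp k j(3) by auto
        have "h k \<in> carrier (Gr k)" using \<Gamma>_carr[OF h(1)] k j(3) by (auto simp: PiE_iff)
        then show ?thesis using g(3) k by (simp add: c_def)
      qed
      moreover have "c i = a \<otimes>\<^bsub>Gr i\<^esub> b \<otimes>\<^bsub>Gr i\<^esub> inv\<^bsub>Gr i\<^esub> a \<otimes>\<^bsub>Gr i\<^esub> inv\<^bsub>Gr i\<^esub> b"
        using g(2) h(2) by (simp add: c_def)
      ultimately show ?thesis using i j by (auto simp: M_def subset_iff intro!: bexI[of _ "restrict c I"])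
    qed
    have "derived (Gr i) N \<subseteq> M (insert j J')"
      unfolding derived_def using comm j by (intro i.generate_subgroup_incl M_sub) auto
    then show ?case using N by (simp add: perfect_subgroup_def)
  qed
  from this[OF J(1)] n show ?thesis by (auto simp: M_def)
qed

section \<open>Stabilizers of multilinear forms\<close>

lemma stabilizer_subgroup:
  assumes grp: "\<And>k. k \<in> I \<Longrightarrow> group (Gr k)"
    and maps: "\<And>k g x. k \<in> I \<Longrightarrow> g \<in> carrier (Gr k) \<Longrightarrow> x \<in> W k \<Longrightarrow> g x \<in> W k"
    and one: "\<And>k x. k \<in> I \<Longrightarrow> x \<in> W k \<Longrightarrow> \<one>\<^bsub>Gr k\<^esub> x = x"
    and mult: "\<And>k g h x. k \<in> I \<Longrightarrow> g \<in> carrier (Gr k) \<Longrightarrow> h \<in> carrier (Gr k) \<Longrightarrow> x \<in> W k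
      \<Longrightarrow> (g \<otimes>\<^bsub>Gr k\<^esub> h) x = g (h x)"
  shows "subgroup {g \<in> carrier (product_group I Gr). \<forall>w\<in>Pi\<^sub>E I W. B (\<lambda>k\<in>I. g k (w k)) = B w}
    (product_group I Gr)" (is "subgroup ?S _")
proof -
  interpret P: group "product_group I Gr" using grp by simp
  have maps': "(\<lambda>k\<in>I. g k (w k)) \<in> Pi\<^sub>E I W"
    if "g \<in> carrier (product_group I Gr)" "w \<in> Pi\<^sub>E I W" for g w
    using that maps by (auto simp: PiE_iff)
  show ?thesis
  proof (rule P.subgroupI)
    show "?S \<subseteq> carrier (product_group I Gr)" by blast
    have "B (\<lambda>k\<in>I. (\<lambda>k\<in>I. \<one>\<^bsub>Gr k\<^esub>) k (w k)) = B w" if "w \<in> Pi\<^sub>E I W" for w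
      using that one by (intro arg_cong[of _ _ B]) (auto simp: PiE_iff extensional_def)
    then have "\<one>\<^bsub>product_group I Gr\<^esub> \<in> ?S" using P.one_closed by simp
    then show "?S \<noteq> {}" by blast
  next
    fix g assume g: "g \<in> ?S"
    then have gP: "g \<in> carrier (product_group I Gr)" and gk: "\<And>k. k \<in> I \<Longrightarrow> g k \<in> carrier (Gr k)"
      by auto
    have inv: "inv\<^bsub>product_group I Gr\<^esub> g = (\<lambda>k\<in>I. inv\<^bsub>Gr k\<^esub> g k)"
      using gP grp by simp
    have "B (\<lambda>k\<in>I. (\<lambda>k\<in>I. inv\<^bsub>Gr k\<^esub> g k) k (w k)) = B w" if w: "w \<in> Pi\<^sub>E I W" for w
    proof -
      define w' where "w' = (\<lambda>k\<in>I. (\<lambda>k\<in>I. inv\<^bsub>Gr k\<^esub> g k) k (w k))"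
      have "w' \<in> Pi\<^sub>E I W" unfolding w'_def
        by (rule maps'[OF _ w]) (use P.inv_closed[OF gP] inv in \<open>simp only:\<close>)
      then have "B (\<lambda>k\<in>I. g k (w' k)) = B w'" using g by blast
      moreover have "g k (w' k) = w k" if k: "k \<in> I" for k
      proof -
        interpret k: group "Gr k" using grp k .
        have wk: "w k \<in> W k" using w k by auto
        have "g k (w' k) = (g k \<otimes>\<^bsub>Gr k\<^esub> inv\<^bsub>Gr k\<^esub> g k) (w k)"
          using mult[OF k gk[OF k] k.inv_closed[OF gk[OF k]] wk] k by (simp add: w'_def)
        then show ?thesis using gk[OF k] one[OF k wk] by simp
      qed
      then have "(\<lambda>k\<in>I. g k (w' k)) = w"
        using w by (auto simp: PiE_iff extensional_def fun_eq_iff)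
      ultimately show ?thesis by (simp add: w'_def)
    qed
    then show "inv\<^bsub>product_group I Gr\<^esub> g \<in> ?S" using P.inv_closed[OF gP] unfolding inv by simp
  next
    fix g h assume g: "g \<in> ?S" and h: "h \<in> ?S"
    have gh: "(\<lambda>k\<in>I. (g \<otimes>\<^bsub>product_group I Gr\<^esub> h) k (w k)) = (\<lambda>k\<in>I. g k ((\<lambda>k\<in>I. h k (w k)) k))"
      if w: "w \<in> Pi\<^sub>E I W" for w
    proof (rule restrict_ext)
      fix k assume k: "k \<in> I"
      have "g k \<in> carrier (Gr k)" "h k \<in> carrier (Gr k)" "w k \<in> W k" using g h w k by auto
      from mult[OF k this] k
      show "(g \<otimes>\<^bsub>product_group I Gr\<^esub> h) k (w k) = g k ((\<lambda>k\<in>I. h k (w k)) k)" by simp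
    qed
    have "B (\<lambda>k\<in>I. (g \<otimes>\<^bsub>product_group I Gr\<^esub> h) k (w k)) = B w" if w: "w \<in> Pi\<^sub>E I W" for w
    proof -
      have "(\<lambda>k\<in>I. h k (w k)) \<in> Pi\<^sub>E I W" using maps' h w by blast
      then have "B (\<lambda>k\<in>I. g k ((\<lambda>k\<in>I. h k (w k)) k)) = B (\<lambda>k\<in>I. h k (w k))" using g by blast
      also have "\<dots> = B w" using h w by blast
      finally show ?thesis unfolding gh[OF w] .
    qed
    moreover have "g \<otimes>\<^bsub>product_group I Gr\<^esub> h \<in> carrier (product_group I Gr)"
      using g h by (intro P.m_closed) blast+
    ultimately show "g \<otimes>\<^bsub>product_group I Gr\<^esub> h \<in> ?S" by blast
  qed
qed

lemma closure_group_linear: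
  assumes "g \<in> carrier (closure_group s G V r)"
  shows "linear_on fun_scale (scalar_ext s V) fun_scale g" "x \<in> scalar_ext s V \<Longrightarrow> g x \<in> scalar_ext s V"
  using assms by (auto simp: closure_group_def Let_def zariski_closure_def GL_def Bij_def bij_betw_def)

lemma closure_group_one: "x \<in> scalar_ext s V \<Longrightarrow> \<one>\<^bsub>closure_group s G V r\<^esub> x = x"
  by (simp add: closure_group_def Let_def GL_def BijGroup_def)

lemma closure_group_mult:
  assumes "g \<in> carrier (closure_group s G V r)" "h \<in> carrier (closure_group s G V r)" "x \<in> scalar_ext s V"
  shows "(g \<otimes>\<^bsub>closure_group s G V r\<^esub> h) x = g (h x)"
proof -
  have "g \<in> Bij (scalar_ext s V)" "h \<in> Bij (scalar_ext s V)"
    using assms by (auto simp: closure_group_def Let_def zariski_closure_def GL_def)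
  then show ?thesis using assms(3) by (simp add: closure_group_def Let_def GL_def BijGroup_def compose_def)
qed

lemma GL_maps: "g \<in> carrier (GL s V) \<Longrightarrow> x \<in> V \<Longrightarrow> g x \<in> V"
  by (auto simp: GL_def Bij_def bij_betw_def)

lemma ext_vec_in_scalar_ext:
  fixes s :: "'k::field \<Rightarrow> 'v::ab_group_add \<Rightarrow> 'v"
  assumes "v \<in> V"
  shows "ext_vec s V v \<in> scalar_ext s V"
proof -
  interpret K: vector_space "fun_scale :: 'k alg_closure \<Rightarrow> ('k, 'v) ext_vector \<Rightarrow> _" by (rule vector_space_fun_scale)
  show ?thesis using assms unfolding scalar_ext_def by (auto intro: K.span_base)
qed

lemma ext_map_maps:
  fixes s :: "'k::field \<Rightarrow> 'v::ab_group_add \<Rightarrow> 'v"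
  assumes "vector_space s" "Modules.module.subspace s V" "g \<in> carrier (GL s V)" "w \<in> scalar_ext s V"
  shows "ext_map s V g w \<in> scalar_ext s V"
proof (rule linear_on_image_span[OF vector_space_fun_scale vector_space_fun_scale,
      where f = "ext_map s V g" and A = "ext_vec s V ` V"])
  interpret K: vector_space "fun_scale :: 'k alg_closure \<Rightarrow> ('k, 'v) ext_vector \<Rightarrow> _" by (rule vector_space_fun_scale)
  show "linear_on fun_scale (K.span (ext_vec s V ` V)) fun_scale (ext_map s V g)"
    using linear_on_ext_map by (simp add: scalar_ext_def)
  show "w \<in> K.span (ext_vec s V ` V)" using assms(4) by (simp add: scalar_ext_def)
  show "K.subspace (scalar_ext s V)" by (simp add: scalar_ext_def K.subspace_span)
  show "ext_map s V g ` ext_vec s V ` V \<subseteq> scalar_ext s V"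
    using ext_map_ext_vec[OF assms(1-3)] GL_maps[OF assms(3)] ext_vec_in_scalar_ext by fastforce
qed

text \<open>
  Both \<open>B (a w)\<close> and \<open>B w\<close> are multilinear in \<open>w\<close>, so the invariance of \<open>b\<close> under \<open>a\<close> gives that
  of \<open>B\<close>. For fixed \<open>w\<close>, the polynomial \<open>B (g w) - B w\<close> in \<open>g\<close> vanishes on the image of \<open>G\<close> and
  therefore on its Zariski closure.
\<close>

lemma closure_stabilizes_form:
  fixes s :: "'k::field \<Rightarrow> 'v::ab_group_add \<Rightarrow> 'v"
  defines "W \<equiv> \<lambda>V. scalar_ext s V"
  assumes s: "vector_space s" and I: "finite I" and V: "\<And>i. i \<in> I \<Longrightarrow> Modules.module.subspace s (V i)"
    and r: "\<And>i a. i \<in> I \<Longrightarrow> a \<in> carrier G \<Longrightarrow> r i a \<in> carrier (GL s (V i))"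
    and b: "\<And>a x. a \<in> carrier G \<Longrightarrow> x \<in> Pi\<^sub>E I V \<Longrightarrow> b (\<lambda>i\<in>I. r i a (x i)) = b x"
    and mB: "multilinear_on fun_scale I (\<lambda>i. W (V i)) (*) B"
    and Bb: "\<And>x. x \<in> Pi\<^sub>E I V \<Longrightarrow> B (\<lambda>i\<in>I. ext_vec s (V i) (x i)) = to_ac (b x)"
    and B_poly: "\<And>w. w \<in> (\<Pi>\<^sub>E i\<in>I. W (V i)) \<Longrightarrow> \<exists>p\<in>poly_funs (product_coeffs fun_scale I (\<lambda>i. W (V i))).
        \<forall>g. (\<forall>i\<in>I. g i (w i) \<in> W (V i)) \<longrightarrow> p g = B (\<lambda>i\<in>I. g i (w i))"
    and g: "g \<in> closure_in_product s G I V r" and w: "w \<in> (\<Pi>\<^sub>E i\<in>I. W (V i))"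
  shows "B (\<lambda>i\<in>I. g i (w i)) = B w"
proof -
  let ?S = "(\<lambda>a. \<lambda>i\<in>I. ext_map s (V i) (r i a)) ` carrier G"
  obtain p where p: "p \<in> poly_funs (product_coeffs fun_scale I (\<lambda>i. W (V i)))"
    "\<And>g. (\<forall>i\<in>I. g i (w i) \<in> W (V i)) \<Longrightarrow> p g = B (\<lambda>i\<in>I. g i (w i))"
    using B_poly[OF w] by blast
  have ext: "ext_map s (V i) (r i a) x \<in> W (V i)" if "i \<in> I" "a \<in> carrier G" "x \<in> W (V i)" for i a x
    using ext_map_maps[OF s V r] that by (simp add: W_def)
  have inv: "B (\<lambda>i\<in>I. ext_map s (V i) (r i a) (w i)) = B w" if a: "a \<in> carrier G" for a
  proof (rule multilinear_on_eqI[OF vector_space_fun_scale I _ _ mB _ w,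
        where A = "\<lambda>i. ext_vec s (V i) ` V i" and F = "\<lambda>w. B (\<lambda>i\<in>I. ext_map s (V i) (r i a) (w i))"])
    show "W (V i) = Modules.module.span fun_scale (ext_vec s (V i) ` V i)" for i
      by (simp add: W_def scalar_ext_def)
    show "multilinear_on fun_scale I (\<lambda>i. W (V i)) (*) (\<lambda>w. B (\<lambda>i\<in>I. ext_map s (V i) (r i a) (w i)))"
    proof (rule multilinear_on_compose[OF mB])
      show "linear_on fun_scale (W (V i)) fun_scale (ext_map s (V i) (r i a))" for i
        unfolding W_def by (rule linear_on_ext_map)
    qed (use ext a in auto)
    fix x assume "x \<in> (\<Pi>\<^sub>E i\<in>I. ext_vec s (V i) ` V i)"
    then have "\<forall>i\<in>I. \<exists>v\<in>V i. x i = ext_vec s (V i) v" by (auto simp: PiE_iff)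
    then obtain v where v: "\<And>i. i \<in> I \<Longrightarrow> v i \<in> V i" "\<And>i. i \<in> I \<Longrightarrow> x i = ext_vec s (V i) (v i)"
      by metis
    have vI: "restrict v I \<in> Pi\<^sub>E I V" using v by auto
    then have rv: "(\<lambda>i\<in>I. r i a (restrict v I i)) \<in> Pi\<^sub>E I V"
      using r[OF _ a] GL_maps by fastforce
    have x_eq: "x = (\<lambda>i\<in>I. ext_vec s (V i) (restrict v I i))"
      using v \<open>x \<in> _\<close> by (auto simp: fun_eq_iff PiE_iff extensional_def)
    have "(\<lambda>i\<in>I. ext_map s (V i) (r i a) (x i))
      = (\<lambda>i\<in>I. ext_vec s (V i) ((\<lambda>i\<in>I. r i a (restrict v I i)) i))"
      using v ext_map_ext_vec[OF s V r[OF _ a]] by (intro restrict_ext) auto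
    then have "B (\<lambda>i\<in>I. ext_map s (V i) (r i a) (x i)) = to_ac (b (\<lambda>i\<in>I. r i a (restrict v I i)))"
      using Bb[OF rv] by simp
    also have "\<dots> = B x" using b[OF a vI] Bb[OF vI] x_eq by simp
    finally show "B (\<lambda>i\<in>I. ext_map s (V i) (r i a) (x i)) = B x" .
  qed
  define q where "q = (\<lambda>g. p g + - B w)"
  have "q \<in> poly_funs (product_coeffs fun_scale I (\<lambda>i. W (V i)))"
    unfolding q_def by (intro poly_funs.add p(1) poly_funs.const)
  moreover have "q h = 0" if "h \<in> ?S" for h
  proof -
    from that obtain a where a: "a \<in> carrier G" "h = (\<lambda>i\<in>I. ext_map s (V i) (r i a))" by auto
    have "p h = B (\<lambda>i\<in>I. h i (w i))" using a ext w by (intro p(2)) (auto simp: PiE_iff)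
    also have "(\<lambda>i\<in>I. h i (w i)) = (\<lambda>i\<in>I. ext_map s (V i) (r i a) (w i))"
      using a(2) by (intro restrict_ext) simp
    also have "B \<dots> = B w" by (rule inv[OF a(1)])
    finally show ?thesis by (simp add: q_def)
  qed
  ultimately have "q g = 0"
    using g unfolding closure_in_product_def zariski_closure_def W_def by blast
  moreover have "p g = B (\<lambda>i\<in>I. g i (w i))"
  proof (intro p(2) ballI)
    fix i assume i: "i \<in> I"
    have "g i \<in> carrier (closure_group s G (V i) (r i))"
      using g i by (auto simp: closure_in_product_def zariski_closure_def)
    then show "g i (w i) \<in> W (V i)" unfolding W_def
      by (rule closure_group_linear) (use w i in \<open>auto simp: W_def\<close>)
  qed
  ultimately show ?thesis by (simp add: q_def)
qed

text \<open>For a single representation, the closure in the product contains the closure group. This covers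
  the case in which there are no indices \<open>j \<noteq> i\<close>.\<close>

lemma closure_in_product_singleton:
  assumes n: "n \<in> carrier (closure_group s G (V i) (r i))"
  shows "(\<lambda>j\<in>{i}. n) \<in> closure_in_product s G {i} V r"
proof -
  have "(\<lambda>h. p (\<lambda>j\<in>{i}. h)) \<in> poly_funs (matrix_coeffs fun_scale (scalar_ext s (V i)))"
    if "p \<in> poly_funs (product_coeffs fun_scale {i} (\<lambda>i. scalar_ext s (V i)))" for p
    using that
  proof induction
    case (coord p)
    then show ?case by (auto simp: product_coeffs_def intro: poly_funs.coord)
  qed (auto intro: poly_funs.intros)
  moreover have "p (\<lambda>j\<in>{i}. n) = 0"
    if "(\<lambda>h. p (\<lambda>j\<in>{i}. h)) \<in> poly_funs (matrix_coeffs fun_scale (scalar_ext s (V i)))"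
      and p: "\<forall>y\<in>(\<lambda>g. \<lambda>i\<in>{i}. ext_map s (V i) (r i g)) ` carrier G. p y = 0" for p
  proof -
    have "(\<lambda>j\<in>{i}. ext_map s (V i) (r i g)) = (\<lambda>i\<in>{i}. ext_map s (V i) (r i g))" for g
      by (intro restrict_ext) simp
    with p have "\<forall>y\<in>(\<lambda>g. ext_map s (V i) (r i g)) ` carrier G. p (\<lambda>j\<in>{i}. y) = 0" by simp
    then show ?thesis
      using n that(1) by (auto simp: closure_group_def Let_def zariski_closure_def)
  qed
  moreover have "(\<lambda>j\<in>{i}. n) \<in> carrier (product_group {i} (\<lambda>i. closure_group s G (V i) (r i)))"
    using n by auto
  ultimately show ?thesis by (simp add: closure_in_product_def zariski_closure_def)
qed


section \<open>Coinvariants\<close>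

lemma coinvariants_zero_iff:
  assumes "vector_space s" "V \<noteq> {}"
  shows "coinvariants_zero s A V \<longleftrightarrow> V \<subseteq> coinv_kernel s A V"
proof -
  interpret vector_space s by fact
  define K where "K = coinv_kernel s A V"
  have K: "subspace K" by (simp add: K_def coinv_kernel_def subspace_span)
  have translate: "(\<lambda>r. v + r) ` K = K \<longleftrightarrow> v \<in> K" for v
  proof
    assume "(\<lambda>r. v + r) ` K = K"
    moreover have "v + 0 \<in> (\<lambda>r. v + r) ` K" using subspace_0[OF K] by blast
    ultimately show "v \<in> K" by simp
  next
    assume v: "v \<in> K"
    have "x \<in> (\<lambda>r. v + r) ` K" if "x \<in> K" for x
      using subspace_diff[OF K that v] by (intro image_eqI[of _ _ "x - v"]) auto
    then show "(\<lambda>r. v + r) ` K = K" using subspace_add[OF K v] by auto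
  qed
  have image: "f ` V = {K} \<longleftrightarrow> (\<forall>v\<in>V. f v = K)" for f using assms(2) by auto
  show ?thesis
    unfolding coinvariants_zero_def coinvariants_def K_def[symmetric] image translate by blast
qed

lemma invariant_linear_form_eq_0:
  assumes s: "vector_space s" and V: "Modules.module.subspace s V" and f: "linear_on s V (*) f"
    and A: "\<And>a v. a \<in> A \<Longrightarrow> v \<in> V \<Longrightarrow> a v \<in> V \<and> f (a v) = f v"
    and z: "coinvariants_zero s A V" and v: "v \<in> V"
  shows "f v = 0"
proof -
  interpret vector_space s by fact
  have f0: "f 0 = 0" by (rule linear_on_zero[OF s V f])
  have "subspace {x \<in> V. f x = 0}"
    using f V f0 by (auto simp: subspace_def linear_on_def)
  moreover have "{a v - v | a v. a \<in> A \<and> v \<in> V} \<subseteq> {x \<in> V. f x = 0}"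
  proof clarify
    fix a v assume av: "a \<in> A" "v \<in> V"
    have d: "a v - v \<in> V" using A[OF av] av subspace_diff[OF V] by auto
    have "f (a v) = f (a v - v) + f v"
      using f d av(2) unfolding linear_on_def by (metis diff_add_cancel)
    then show "a v - v \<in> V \<and> f (a v - v) = 0" using d A[OF av] by simp
  qed
  ultimately have "coinv_kernel s A V \<subseteq> {x \<in> V. f x = 0}"
    unfolding coinv_kernel_def by (intro span_minimal)
  moreover have "V \<noteq> {}" using v by auto
  ultimately show ?thesis using z v coinvariants_zero_iff[OF s] by blast
qed

text \<open>Linear forms on the coinvariants of the tensor product are the invariant multilinear
  forms on the factors.\<close>

lemma tensor_coinvariants_zero:
  fixes s :: "'k::field \<Rightarrow> 'v::ab_group_add \<Rightarrow> 'v"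
  assumes s: "vector_space s" and V: "\<And>i. i \<in> I \<Longrightarrow> Modules.module.subspace s (V i)"
    and r: "\<And>i a. i \<in> I \<Longrightarrow> a \<in> A \<Longrightarrow> r i a \<in> carrier (GL s (V i))"
    and forms: "\<And>b x. b \<in> multilinear_forms s I V
      \<Longrightarrow> (\<And>a x. a \<in> A \<Longrightarrow> x \<in> Pi\<^sub>E I V \<Longrightarrow> b (\<lambda>i\<in>I. r i a (x i)) = b x)
      \<Longrightarrow> x \<in> Pi\<^sub>E I V \<Longrightarrow> b x = 0"
  shows "coinvariants_zero fun_scale ((\<lambda>a. tensor_map s I V (\<lambda>i. r i a)) ` A) (tensor_space s I V)"
proof -
  interpret s: vector_space s by fact
  interpret T: vector_space "fun_scale :: 'k \<Rightarrow> ('k, 'i, 'v) tensor \<Rightarrow> _" by (rule vector_space_fun_scale)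
  let ?A = "(\<lambda>a. tensor_map s I V (\<lambda>i. r i a)) ` A" and ?T = "tensor_space s I V"
  let ?K = "coinv_kernel fun_scale ?A ?T"
  have K: "T.subspace ?K" by (simp add: coinv_kernel_def T.subspace_span)
  have "pure_tensor s I V x \<in> ?K" if x: "x \<in> Pi\<^sub>E I V" for x
  proof (rule ccontr)
    assume "pure_tensor s I V x \<notin> ?K"
    from separating_linear_form[OF vector_space_fun_scale K this] obtain \<phi> where
      lin: "Vector_Spaces.linear fun_scale (*) \<phi>" and \<phi>K: "\<And>t. t \<in> ?K \<Longrightarrow> \<phi> t = 0"
      and \<phi>x: "\<phi> (pure_tensor s I V x) \<noteq> 0" by blast
    interpret \<phi>: Vector_Spaces.linear fun_scale "(*)" \<phi> by (rule lin)
    define b where "b x = (if x \<in> Pi\<^sub>E I V then \<phi> (pure_tensor s I V x) else 0)" for x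
    have "b \<in> multilinear_forms s I V"
      unfolding multilinear_forms_def multilinear_on_def
    proof (intro CollectI conjI ballI allI impI)
      fix x i assume xi: "x \<in> Pi\<^sub>E I V" "i \<in> I"
      have "linear_on s (V i) fun_scale (\<lambda>v. pure_tensor s I V (x(i := v)))"
        using multilinear_on_pure_tensor[OF s, of I V] V xi by (simp add: multilinear_on_def)
      then show "linear_on s (V i) (*) (\<lambda>v. b (x(i := v)))"
        using PiE_upd[OF xi] s.subspace_add[OF V[OF xi(2)]] s.subspace_scale[OF V[OF xi(2)]]
        by (simp add: linear_on_def b_def \<phi>.add \<phi>.scale)
    qed (simp add: b_def)
    moreover have "b (\<lambda>i\<in>I. r i a (x i)) = b x" if a: "a \<in> A" and x: "x \<in> Pi\<^sub>E I V" for a x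
    proof -
      have rx: "(\<lambda>i\<in>I. r i a (x i)) \<in> Pi\<^sub>E I V" using r[OF _ a] x GL_maps by fastforce
      have "pure_tensor s I V x \<in> ?T" unfolding tensor_space_def using x by (auto intro: T.span_base)
      then have "tensor_map s I V (\<lambda>i. r i a) (pure_tensor s I V x) - pure_tensor s I V x \<in> ?K"
        unfolding coinv_kernel_def using a by (intro T.span_base) blast
      then have "pure_tensor s I V (\<lambda>i\<in>I. r i a (x i)) - pure_tensor s I V x \<in> ?K"
        using tensor_map_pure_tensor[OF s V r[OF _ a] x] by simp
      from \<phi>K[OF this] show ?thesis using x rx by (simp add: b_def \<phi>.diff)
    qed
    ultimately have "b x = 0" using x by (rule forms)
    then show False using \<phi>x x by (simp add: b_def)
  qed
  then have "T.span (pure_tensor s I V ` Pi\<^sub>E I V) \<subseteq> ?K"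
    by (intro T.span_minimal K) auto
  then have "?T \<subseteq> ?K" by (simp only: tensor_space_def)
  moreover have "?T \<noteq> {}" using T.span_zero by (auto simp: tensor_space_def)
  ultimately show ?thesis using coinvariants_zero_iff[OF vector_space_fun_scale] by blast
qed


section \<open>Vanishing of invariant multilinear forms\<close>

lemma invariant_multilinear_form_eq_0:
  fixes s :: "'k::field \<Rightarrow> 'v::ab_group_add \<Rightarrow> 'v"
    and N :: "(('k, 'v) ext_vector \<Rightarrow> ('k, 'v) ext_vector) set"
  assumes s: "vector_space s" and I: "finite I" and V: "\<And>j. j \<in> I \<Longrightarrow> fin_dim_subspace s (V j)"
    and r: "\<And>j a. j \<in> I \<Longrightarrow> a \<in> carrier G \<Longrightarrow> r j a \<in> carrier (GL s (V j))"
    and grp: "\<And>j. j \<in> I \<Longrightarrow> group (closure_group s G (V j) (r j))"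
    and i: "i \<in> I" and N: "perfect_subgroup (closure_group s G (V i) (r i)) N"
    and coinv: "coinvariants_zero fun_scale N (scalar_ext s (V i))"
    and kernel: "\<And>j. j \<in> I \<Longrightarrow> j \<noteq> i \<Longrightarrow> N \<subseteq> goursat_kernel s G I V r i j"
    and b: "b \<in> multilinear_forms s I V"
    and inv: "\<And>a x. a \<in> carrier G \<Longrightarrow> x \<in> Pi\<^sub>E I V \<Longrightarrow> b (\<lambda>i\<in>I. r i a (x i)) = b x"
    and x: "x \<in> Pi\<^sub>E I V"
  shows "b x = 0"
proof -
  interpret K: vector_space "fun_scale :: 'k alg_closure \<Rightarrow> ('k, 'v) ext_vector \<Rightarrow> _" by (rule vector_space_fun_scale)
  have sub: "Modules.module.subspace s (V j)" if "j \<in> I" for j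
    using V[OF that] by (simp add: fin_dim_subspace_def)
  define W where "W j = scalar_ext s (V j)" for j
  define Gr where "Gr j = closure_group s G (V j) (r j)" for j
  have W_sub: "K.subspace (W j)" for j by (simp add: W_def scalar_ext_def K.subspace_span)
  obtain B where mB: "multilinear_on fun_scale I W (*) B"
    and Bb: "\<And>x. x \<in> Pi\<^sub>E I V \<Longrightarrow> B (\<lambda>i\<in>I. ext_vec s (V i) (x i)) = to_ac (b x)"
    and B_poly: "\<And>w. w \<in> Pi\<^sub>E I W \<Longrightarrow> \<exists>p\<in>poly_funs (product_coeffs fun_scale I W).
        \<forall>g. (\<forall>i\<in>I. g i (w i) \<in> W i) \<longrightarrow> p g = B (\<lambda>i\<in>I. g i (w i))"
    using multilinear_form_scalar_ext[OF s I V b] unfolding W_def by blast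
  define \<Gamma> where "\<Gamma> = {g \<in> carrier (product_group I Gr). \<forall>w\<in>Pi\<^sub>E I W. B (\<lambda>k\<in>I. g k (w k)) = B w}"
  have \<Gamma>: "subgroup \<Gamma> (product_group I Gr)"
    unfolding \<Gamma>_def
  proof (rule stabilizer_subgroup)
    show "group (Gr k)" if "k \<in> I" for k using grp that by (simp add: Gr_def)
  qed (auto simp: W_def Gr_def closure_group_one closure_group_mult closure_group_linear(2))
  have cl: "closure_in_product s G I V r \<subseteq> \<Gamma>"
  proof
    fix g assume g: "g \<in> closure_in_product s G I V r"
    then have "g \<in> carrier (product_group I Gr)"
      by (simp add: closure_in_product_def zariski_closure_def Gr_def)
    moreover have "B (\<lambda>i\<in>I. g i (w i)) = B w" if "w \<in> Pi\<^sub>E I W" for w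
      by (rule closure_stabilizes_form[OF s I sub r inv mB[unfolded W_def] Bb B_poly[unfolded W_def] g
            that[unfolded W_def]])
    ultimately show "g \<in> \<Gamma>" by (simp add: \<Gamma>_def)
  qed
  have pair: "\<exists>g\<in>\<Gamma>. g i = n \<and> g j = \<one>\<^bsub>Gr j\<^esub>" if "n \<in> N" "j \<in> I - {i}" for n j
  proof -
    have "n \<in> goursat_kernel s G I V r i j" using kernel that by auto
    then obtain g where "g \<in> closure_in_product s G I V r" "g i = n" "g j = \<one>\<^bsub>Gr j\<^esub>"
      by (auto simp: goursat_kernel_def goursat_datum_def Let_def Gr_def)
    then show ?thesis using cl by auto
  qed
  have NC: "N \<subseteq> carrier (Gr i)"
    using N by (auto simp: Gr_def perfect_subgroup_def dest: subgroup.subset)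
  have base: "\<exists>g\<in>\<Gamma>. g i = n" if n: "n \<in> N" for n
  proof (cases "I = {i}")
    case True
    have "(\<lambda>j\<in>{i}. n) \<in> closure_in_product s G I V r"
      unfolding True using NC n by (intro closure_in_product_singleton) (auto simp: Gr_def)
    then show ?thesis using cl by (intro bexI[of _ "\<lambda>j\<in>{i}. n"]) auto
  next
    case False
    with i obtain j where "j \<in> I - {i}" by auto
    with pair[OF n] show ?thesis by blast
  qed
  \<comment> \<open>as a linear form in the \<open>i\<close>-th argument, \<open>B\<close> is invariant under \<open>N\<close>\<close>
  define y where "y = (\<lambda>j\<in>I. ext_vec s (V j) (x j))"
  have y: "y \<in> Pi\<^sub>E I W" using x by (auto simp: y_def W_def PiE_iff intro: ext_vec_in_scalar_ext)
  have "B (y(i := y i)) = 0"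
  proof (rule invariant_linear_form_eq_0[OF vector_space_fun_scale W_sub[of i],
        where A = N and f = "\<lambda>v. B (y(i := v))"])
    show "linear_on fun_scale (W i) (*) (\<lambda>v. B (y(i := v)))"
      using mB y i by (simp add: multilinear_on_def)
    show "coinvariants_zero fun_scale N (W i)" using coinv by (simp add: W_def)
    show "y i \<in> W i" using y i by auto
    fix n v assume n: "n \<in> N" and v: "v \<in> W i"
    obtain g where g: "g \<in> \<Gamma>" "g i = n" "\<forall>j\<in>I - {i}. g j = \<one>\<^bsub>Gr j\<^esub>"
      using perfect_subgroup_lift[OF _ \<Gamma> i _ base pair _ _ n] grp N I unfolding Gr_def by blast
    have yv: "y(i := v) \<in> Pi\<^sub>E I W" using y i v by (rule PiE_upd)
    have "(\<lambda>k\<in>I. g k ((y(i := v)) k)) = y(i := n v)"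
    proof
      fix k show "(\<lambda>k\<in>I. g k ((y(i := v)) k)) k = (y(i := n v)) k"
        using g(2,3) y i closure_group_one[of "y k" s "V k" G "r k"]
        by (cases "k \<in> I") (auto simp: PiE_iff extensional_def Gr_def W_def)
    qed
    then have "B (y(i := n v)) = B (y(i := v))" using g(1) yv by (auto simp: \<Gamma>_def)
    moreover have "n v \<in> W i" using NC n v closure_group_linear(2) by (fastforce simp: Gr_def W_def)
    ultimately show "n v \<in> W i \<and> B (y(i := n v)) = B (y(i := v))" by blast
  qed
  then have "B y = 0" by simp
  then show ?thesis using Bb[OF x] by (simp add: y_def)
qed

theorem proposition3p3:
  fixes scale :: "'k::field \<Rightarrow> 'v::ab_group_add \<Rightarrow> 'v"
    and G :: "'g monoid"
    and m :: nat
    and V :: "nat \<Rightarrow> 'v set"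
    and \<rho> :: "nat \<Rightarrow> 'g \<Rightarrow> 'v \<Rightarrow> 'v"
    and N :: "nat \<Rightarrow> (('k, 'v) ext_vector \<Rightarrow> ('k, 'v) ext_vector) set"
  assumes "vector_space scale"
    and "group G"
    and "m \<ge> 1"
    and "\<And>i. i \<in> {1..m} \<Longrightarrow> fin_dim_subspace scale (V i)"
    and "\<And>i. i \<in> {1..m} \<Longrightarrow> \<rho> i \<in> hom G (GL scale (V i))"
    and "\<And>i. i \<in> {1..m} \<Longrightarrow> N i \<lhd> closure_group scale G (V i) (\<rho> i)"
    and "\<And>i. i \<in> {1..m} \<Longrightarrow> perfect_subgroup (closure_group scale G (V i) (\<rho> i)) (N i)"
    and "\<And>i. i \<in> {1..m} \<Longrightarrow> coinvariants_zero fun_scale (N i) (scalar_ext scale (V i))"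
  shows "coinvariants_zero fun_scale
           ((\<lambda>g. tensor_map scale {1..m} V (\<lambda>i. \<rho> i g)) ` carrier G)
           (tensor_space scale {1..m} V)
       \<or> (\<forall>i\<in>{1..m}. \<exists>j\<in>{1..m}. j \<noteq> i \<and>
            \<not> N i \<subseteq> goursat_kernel scale G {1..m} V \<rho> i j)"
proof (rule disjCI)
  assume "\<not> (\<forall>i\<in>{1..m}. \<exists>j\<in>{1..m}. j \<noteq> i \<and> \<not> N i \<subseteq> goursat_kernel scale G {1..m} V \<rho> i j)"
  then obtain i where i: "i \<in> {1..m}"
    and kernel: "\<And>j. j \<in> {1..m} \<Longrightarrow> j \<noteq> i \<Longrightarrow> N i \<subseteq> goursat_kernel scale G {1..m} V \<rho> i j"
    by blast
  have sub: "Modules.module.subspace scale (V j)" if "j \<in> {1..m}" for j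
    using assms(4)[OF that] by (simp add: fin_dim_subspace_def)
  have \<rho>: "\<rho> j a \<in> carrier (GL scale (V j))" if "j \<in> {1..m}" "a \<in> carrier G" for j a
    using assms(5)[OF that(1)] that(2) by (auto simp: hom_def)
  have grp: "group (closure_group scale G (V j) (\<rho> j))" if "j \<in> {1..m}" for j
    using assms(6)[OF that] by (rule normal.axioms(2))
  show "coinvariants_zero fun_scale
           ((\<lambda>g. tensor_map scale {1..m} V (\<lambda>i. \<rho> i g)) ` carrier G) (tensor_space scale {1..m} V)"
  proof (rule tensor_coinvariants_zero[where s = scale and r = \<rho>])
    show "vector_space scale" by fact
    show "Modules.module.subspace scale (V j)" if "j \<in> {1..m}" for j using that by (rule sub)
    show "\<rho> j a \<in> carrier (GL scale (V j))" if "j \<in> {1..m}" "a \<in> carrier G" for j a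
      using that by (rule \<rho>)
    fix b x
    assume b: "b \<in> multilinear_forms scale {1..m} V"
      and inv: "\<And>a x. a \<in> carrier G \<Longrightarrow> x \<in> Pi\<^sub>E {1..m} V \<Longrightarrow> b (\<lambda>i\<in>{1..m}. \<rho> i a (x i)) = b x"
      and x: "x \<in> Pi\<^sub>E {1..m} V"
    show "b x = 0"
    proof (rule invariant_multilinear_form_eq_0[where s = scale and r = \<rho> and N = "N i" and i = i
          and G = G and V = V and I = "{1..m}" and b = b])
      show "b (\<lambda>j\<in>{1..m}. \<rho> j a (x j)) = b x" if "a \<in> carrier G" "x \<in> Pi\<^sub>E {1..m} V" for a x
        using inv that .
    qed (assumption | rule finite_atLeastAtMost assms(1,4) \<rho> grp i assms(7)[OF i] assms(8)[OF i] kernel b x)+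
  qed
qed

end
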